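(* Let $X\subseteq\mathbb{Z}^m$ and $Y\subseteq\mathbb{Z}^n$ be digital images both with $c_1$-adjacency, with $m\le 3$, and let $f,g:X\to Y$ be homotopic continuous functions. Then the induced homomorphisms $\bar f_*,\bar g_*:\bar H^{c_1}_q(X)\to\bar H^{c_1}_q(Y)$ on $c_1$-cubical homology are equal for each $q\ge 0$. Moreover, suppose the following assertion holds: for all $a,b$, all digital images $A\subset\mathbb{Z}^a$ and $B\subset\mathbb{Z}^b$ with $c_1$-adjacency, and every continuous $h:A\to B$, the family of homomorphisms $\bar h_\#:\bar C^{c_1}_q(A)\to\bar C^{c_1}_q(B)$ is a chain map. Then the conclusion $\bar f_*=\bar g_*$ (for each $q$) holds for homotopic continuous $f,g : X \to Y$ with any $m$, without the restriction $m\le 3$.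
   Context: A digital image is a set with a symmetric, antireflexive adjacency relation; a function between digital images is continuous if it sends adjacent points to points that are adjacent or equal. On $\mathbb{Z}^n$, $c_1$-adjacency: two points are adjacent iff they differ by exactly $1$ in exactly one coordinate and agree in all others. $[0,k]_{\mathbb{Z}}=\{0,\dots,k\}$ with $c_1$-adjacency. Homotopy. Continuous $f,g:X\to Y$ are homotopic if for some positive integer $k$ there is $H:X\times[0,k]_{\mathbb{Z}}\to Y$ with $H(x,0)=f(x)$, $H(x,k)=g(x)$ for all $x$, such that $t\mapsto H(x,t)$ is continuous for each $x$ and $x\mapsto H(x,t)$ is continuous for each $t$. $c_1$-cubical homology. An elementary interval is a set $\{a\}$ (degenerate) or $\{a,a+1\}$ (nondegenerate), $a\in\mathbb{Z}$. An elementary cube in $\mathbb{Z}^n$ is $Q=J_1\times\dots\times J_n$ with each $J_i$ an elementary interval; its dimension is the number of nondegenerate factors, and an elementary $q$-cube is one of dimension $q$. For $X\subset\mathbb{Z}^n$ with $c_1$-adjacency, $\bar C^{c_1}_q(X)$ is the free abelian group on the elementary $q$-cubes contained in $X$. Let $A_iQ$ (resp. $B_iQ$) be obtained from $Q$ by replacing $J_i$ by $\{\min J_i\}$ (resp. $\{\max J_i\}$). If $j_1<\dots<j_q$ are the indices with $J_{j_i}$ nondegenerate, $\partial_qQ=\sum_{i=1}^q(-1)^i(A_{j_i}Q-B_{j_i}Q)$. $\bar H^{c_1}_q(X)$ is the $q$-th homology group of $(\bar C^{c_1}_q(X),\partial_q)$. Induced maps. Let $f:X\to Y$ be continuous ($c_1$-adjacency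 on both). For an elementary $q$-cube $Q\subset X$, say $f$ is an embedding on $Q$ if $f(Q)$ is an elementary $q$-cube in $Y$. In that case $f|_Q$ is the restriction of an affine map, and $\epsilon_{f,Q}\in\{-1,1\}$ is the determinant of its linear part with respect to the nondegenerate coordinate directions of $Q$ and of $f(Q)$, each listed in increasing order (equal to $1$ if $q=0$). If $f$ is not an embedding on $Q$, set $\epsilon_{f,Q}=0$. Define $\bar f_\#(Q)=\epsilon_{f,Q}\,f(Q)$, extended linearly to $\bar f_\#:\bar C^{c_1}_q(X)\to\bar C^{c_1}_q(Y)$. When $\bar f_\#$ is a chain map (which is the case when the domain lies in $\mathbb{Z}^n$ with $n\le 4$), $\bar f_*$ denotes the induced homomorphism on homology. *)

theory Defs
  imports "HOL-Algebra.Free_Abelian_Groups" "Jordan_Normal_Form.Determinant"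
begin

section \<open>Digital images\<close>

text \<open>Points of \<open>\<int>\<^sup>n\<close> are integer lists of length \<open>n\<close>, so that the dimension can be quantified
  over inside a formula. A digital image is given by a carrier set together with an adjacency
  relation.\<close>

definition int_lattice :: "nat \<Rightarrow> int list set" where
  "int_lattice n = {x. length x = n}"

definition c1_adj :: "int list \<Rightarrow> int list \<Rightarrow> bool" where
  "c1_adj x y \<longleftrightarrow> length x = length y \<and>
     (\<exists>i < length x. \<bar>x ! i - y ! i\<bar> = 1 \<and> (\<forall>j < length x. j \<noteq> i \<longrightarrow> x ! j = y ! j))"

lemma c1_adj_sym: "c1_adj x y \<Longrightarrow> c1_adj y x"
  unfolding c1_adj_def by (metis abs_minus_commute)

lemma c1_adj_irrefl: "\<not> c1_adj x x"
  by (simp add: c1_adj_def)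

definition digital_continuous ::
    "'a set \<Rightarrow> ('a \<Rightarrow> 'a \<Rightarrow> bool) \<Rightarrow> 'b set \<Rightarrow> ('b \<Rightarrow> 'b \<Rightarrow> bool) \<Rightarrow> ('a \<Rightarrow> 'b) \<Rightarrow> bool" where
  "digital_continuous X adjX Y adjY f \<longleftrightarrow>
     f \<in> X \<rightarrow> Y \<and> (\<forall>x\<in>X. \<forall>y\<in>X. adjX x y \<longrightarrow> f x = f y \<or> adjY (f x) (f y))"

text \<open>The digital interval \<open>[0,k]\<close> is the set \<open>{0..k}\<close> of integers, where \<open>s\<close> and \<open>t\<close> are adjacent
  iff they differ by exactly 1 (this is \<open>c\<^sub>1\<close>-adjacency in dimension one).\<close>

definition digital_homotopic ::
    "'a set \<Rightarrow> ('a \<Rightarrow> 'a \<Rightarrow> bool) \<Rightarrow> 'b set \<Rightarrow> ('b \<Rightarrow> 'b \<Rightarrow> bool) \<Rightarrow> ('a \<Rightarrow> 'b) \<Rightarrow> ('a \<Rightarrow> 'b) \<Rightarrow> bool" where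
  "digital_homotopic X adjX Y adjY f g \<longleftrightarrow>
     (\<exists>k::int. 0 < k \<and> (\<exists>H :: 'a \<Rightarrow> int \<Rightarrow> 'b.
        (\<forall>x\<in>X. H x 0 = f x \<and> H x k = g x) \<and>
        (\<forall>x\<in>X. digital_continuous {0..k} (\<lambda>s t. \<bar>s - t\<bar> = 1) Y adjY (H x)) \<and>
        (\<forall>t\<in>{0..k}. digital_continuous X adjX Y adjY (\<lambda>x. H x t))))"

abbreviation c1_continuous :: "int list set \<Rightarrow> int list set \<Rightarrow> (int list \<Rightarrow> int list) \<Rightarrow> bool" where
  "c1_continuous X Y \<equiv> digital_continuous X c1_adj Y c1_adj"

abbreviation c1_homotopic ::
    "int list set \<Rightarrow> int list set \<Rightarrow> (int list \<Rightarrow> int list) \<Rightarrow> (int list \<Rightarrow> int list) \<Rightarrow> bool" where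
  "c1_homotopic X Y \<equiv> digital_homotopic X c1_adj Y c1_adj"

section \<open>Elementary cubes\<close>

definition elementary_interval :: "int set \<Rightarrow> bool" where
  "elementary_interval J \<longleftrightarrow> (\<exists>a. J = {a} \<or> J = {a, a + 1})"

definition nondegenerate :: "int set \<Rightarrow> bool" where
  "nondegenerate J \<longleftrightarrow> (\<exists>a. J = {a, a + 1})"

text \<open>\<^term>\<open>listset Js\<close> is the Cartesian product of the sets in the list \<^term>\<open>Js\<close>. The ambient
  dimension of a cube is implicit as the number of its factors.\<close>

definition elementary_cube :: "int list set \<Rightarrow> bool" where
  "elementary_cube Q \<longleftrightarrow> (\<exists>Js. (\<forall>J\<in>set Js. elementary_interval J) \<and> Q = listset Js)"

definition factors :: "int list set \<Rightarrow> int set list" where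
  "factors Q = (THE Js. (\<forall>J\<in>set Js. elementary_interval J) \<and> Q = listset Js)"

text \<open>The indices of the nondegenerate factors in increasing order. Coordinates are numbered
  from 0.\<close>

definition nondeg_dirs :: "int list set \<Rightarrow> nat list" where
  "nondeg_dirs Q = filter (\<lambda>i. nondegenerate (factors Q ! i)) [0..<length (factors Q)]"

definition cube_dim :: "int list set \<Rightarrow> nat" where
  "cube_dim Q = length (nondeg_dirs Q)"

definition lower_face :: "nat \<Rightarrow> int list set \<Rightarrow> int list set" where
  "lower_face i Q = listset ((factors Q)[i := {Min (factors Q ! i)}])"

definition upper_face :: "nat \<Rightarrow> int list set \<Rightarrow> int list set" where
  "upper_face i Q = listset ((factors Q)[i := {Max (factors Q ! i)}])"

lemma listset_eq_iff:
  assumes "\<forall>J\<in>set Js. J \<noteq> {}" "\<forall>J\<in>set Ks. J \<noteq> {}"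
  shows "listset Js = listset Ks \<longleftrightarrow> Js = Ks"
proof -
  have ne: "listset Ls \<noteq> {}" if "\<forall>J\<in>set Ls. J \<noteq> {}" for Ls :: "'a set list"
    using that by (induction Ls) (fastforce simp: set_Cons_def)+
  have inj: "A = B \<and> U = V"
    if "set_Cons A U = set_Cons B V" "A \<noteq> {}" "U \<noteq> {}" "B \<noteq> {}" "V \<noteq> {}"
    for A B :: "'a set" and U V
  proof -
    have "x \<in> A \<and> u \<in> U \<longleftrightarrow> x \<in> B \<and> u \<in> V" for x u
      using arg_cong[OF that(1), of "\<lambda>S. x # u \<in> S"] by (simp add: set_Cons_def)
    with that(2-5) show ?thesis by blast
  qed
  from assms show ?thesis
  proof (induction Js arbitrary: Ks)
    case Nil
    then show ?case by (cases Ks) (auto simp: set_Cons_def)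
  next
    case (Cons J Js)
    show ?case
    proof (cases Ks)
      case Nil
      then show ?thesis by (auto simp: set_Cons_def)
    next
      case (Cons K Ls)
      then show ?thesis using Cons.IH[of Ls] Cons.prems inj[of J "listset Js" K "listset Ls"] ne
        by auto
    qed
  qed
qed

lemma factors_listset:
  assumes "\<forall>J\<in>set Js. elementary_interval J"
  shows "factors (listset Js) = Js"
  unfolding factors_def
proof (rule the_equality)
  fix Ks assume "(\<forall>J\<in>set Ks. elementary_interval J) \<and> listset Js = listset Ks"
  then show "Ks = Js"
    using assms listset_eq_iff[of Js Ks] by (auto simp: elementary_interval_def)
qed (use assms in simp)

section \<open>Cubical homology\<close>

text \<open>Chains are formal integer combinations of cubes; the graded pieces of the complex differ only
  in their carriers, and the boundary operator is one map on all chains. For a cube \<open>Q\<close> of dimension 0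
  the sum below is empty, so the boundary vanishes in degree 0.\<close>

definition cube_chain_group :: "nat \<Rightarrow> int list set \<Rightarrow> (int list set \<Rightarrow>\<^sub>0 int) monoid" where
  "cube_chain_group q X = free_Abelian_group {Q. elementary_cube Q \<and> cube_dim Q = q \<and> Q \<subseteq> X}"

definition cube_boundary :: "(int list set \<Rightarrow>\<^sub>0 int) \<Rightarrow> (int list set \<Rightarrow>\<^sub>0 int)" where
  "cube_boundary = frag_extend (\<lambda>Q. \<Sum>i = 1..cube_dim Q.
     frag_cmul ((-1) ^ i) (frag_of (lower_face (nondeg_dirs Q ! (i - 1)) Q) -
                           frag_of (upper_face (nondeg_dirs Q ! (i - 1)) Q)))"

definition cube_cycles :: "nat \<Rightarrow> int list set \<Rightarrow> (int list set \<Rightarrow>\<^sub>0 int) set" where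
  "cube_cycles q X = {c \<in> carrier (cube_chain_group q X). cube_boundary c = 0}"

definition cube_boundaries :: "nat \<Rightarrow> int list set \<Rightarrow> (int list set \<Rightarrow>\<^sub>0 int) set" where
  "cube_boundaries q X = cube_boundary ` carrier (cube_chain_group (Suc q) X)"

definition cube_homology_group ::
    "nat \<Rightarrow> int list set \<Rightarrow> (int list set \<Rightarrow>\<^sub>0 int) set monoid" where
  "cube_homology_group q X =
     subgroup_generated (cube_chain_group q X) (cube_cycles q X) Mod cube_boundaries q X"

section \<open>Induced maps\<close>

text \<open>The condition that \<open>f ` Q\<close> is contained in the codomain is left out: it always holds for
  \<open>Q \<subseteq> X\<close> and \<open>f \<in> X \<rightarrow> Y\<close>.\<close>

definition embedding_on :: "(int list \<Rightarrow> int list) \<Rightarrow> int list set \<Rightarrow> bool" where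
  "embedding_on f Q \<longleftrightarrow> elementary_cube (f ` Q) \<and> cube_dim (f ` Q) = cube_dim Q"

text \<open>The matrix of the linear part of the affine map \<open>f\<close> restricted to \<open>Q\<close>: its columns are
  \<open>f (v + e\<^sub>j) - f v\<close>, where \<open>v\<close> is the minimal vertex of \<open>Q\<close> and \<open>j\<close> runs through the
  nondegenerate directions of \<open>Q\<close>; its rows are indexed by the nondegenerate directions
  of \<open>f ` Q\<close>.\<close>

definition linear_part :: "(int list \<Rightarrow> int list) \<Rightarrow> int list set \<Rightarrow> int mat" where
  "linear_part f Q =
     (let v = map Min (factors Q); js = nondeg_dirs Q; ks = nondeg_dirs (f ` Q)
      in mat (length ks) (length js)
           (\<lambda>(r, c). f (v[js ! c := v ! (js ! c) + 1]) ! (ks ! r) - f v ! (ks ! r)))"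

definition cube_sign :: "(int list \<Rightarrow> int list) \<Rightarrow> int list set \<Rightarrow> int" where
  "cube_sign f Q = (if embedding_on f Q then det (linear_part f Q) else 0)"

definition cube_map ::
    "(int list \<Rightarrow> int list) \<Rightarrow> (int list set \<Rightarrow>\<^sub>0 int) \<Rightarrow> (int list set \<Rightarrow>\<^sub>0 int)" where
  "cube_map f = frag_extend (\<lambda>Q. frag_cmul (cube_sign f Q) (frag_of (f ` Q)))"

definition cube_chain_map ::
    "int list set \<Rightarrow> int list set \<Rightarrow> ((int list set \<Rightarrow>\<^sub>0 int) \<Rightarrow> (int list set \<Rightarrow>\<^sub>0 int)) \<Rightarrow> bool" where
  "cube_chain_map X Y \<phi> \<longleftrightarrow>
     (\<forall>q. \<phi> \<in> hom (cube_chain_group q X) (cube_chain_group q Y) \<and>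
          (\<forall>c \<in> carrier (cube_chain_group q X). cube_boundary (\<phi> c) = \<phi> (cube_boundary c)))"

text \<open>The class \<open>K\<close>, a coset of the boundaries of \<open>X\<close>, is sent to the sum of the boundaries of
  \<open>Y\<close> and the image of \<open>K\<close>. When the map on chains is a chain map this is the usual induced map,
  by \<open>cube_induced_class\<close> below.\<close>

definition cube_induced ::
    "nat \<Rightarrow> int list set \<Rightarrow> int list set \<Rightarrow> (int list \<Rightarrow> int list) \<Rightarrow>
     (int list set \<Rightarrow>\<^sub>0 int) set \<Rightarrow> (int list set \<Rightarrow>\<^sub>0 int) set" where
  "cube_induced q X Y f =
     (\<lambda>K \<in> carrier (cube_homology_group q X).
        cube_boundaries q Y <#>\<^bsub>cube_chain_group q Y\<^esub> (cube_map f ` K))"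

lemma cube_induced_class:
  assumes chain: "cube_chain_map X Y (cube_map f)" and z: "z \<in> cube_cycles q X"
  shows "cube_induced q X Y f (cube_boundaries q X #>\<^bsub>cube_chain_group q X\<^esub> z) =
         cube_boundaries q Y #>\<^bsub>cube_chain_group q Y\<^esub> cube_map f z"
proof -
  have coset: "S #>\<^bsub>cube_chain_group q W\<^esub> c = (\<lambda>b. b + c) ` S" for S c W
    by (auto simp: r_coset_def cube_chain_group_def)
  have setmult: "S <#>\<^bsub>cube_chain_group q W\<^esub> T = (\<Union>b\<in>S. (\<lambda>c. b + c) ` T)" for S T W
    by (auto simp: set_mult_def cube_chain_group_def)
  let ?BX = "cube_boundaries q X" and ?BY = "cube_boundaries q Y"
  have cl: "a + b \<in> carrier (cube_chain_group p W)"
    if "a \<in> carrier (cube_chain_group p W)" "b \<in> carrier (cube_chain_group p W)" for a b p W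
    using that Poly_Mapping.keys_add[of a b]
    by (simp add: cube_chain_group_def free_Abelian_group_def) blast
  have add: "cube_map f (a + b) = cube_map f a + cube_map f b" for a b
    by (simp add: cube_map_def frag_extend_add)
  have sub: "a + b \<in> ?BY" if "a \<in> ?BY" "b \<in> ?BY" for a b
    using that unfolding cube_boundaries_def
    by (auto simp: cube_boundary_def frag_extend_add[symmetric] intro!: imageI cl)
  have zero: "0 \<in> ?BX"
    unfolding cube_boundaries_def
    by (rule image_eqI[of _ _ 0])
       (auto simp: cube_boundary_def cube_chain_group_def free_Abelian_group_def)
  have zero': "cube_map f 0 = 0" by (simp add: cube_map_def)
  have img: "cube_map f b \<in> ?BY" if "b \<in> ?BX" for b
  proof -
    from that obtain c where c: "c \<in> carrier (cube_chain_group (Suc q) X)" "b = cube_boundary c"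
      by (auto simp: cube_boundaries_def)
    with chain have "cube_map f b = cube_boundary (cube_map f c)"
      by (simp add: cube_chain_map_def)
    moreover have "cube_map f c \<in> carrier (cube_chain_group (Suc q) Y)"
      using chain c(1) by (auto simp: cube_chain_map_def hom_def)
    ultimately show ?thesis by (simp add: cube_boundaries_def)
  qed
  have "z \<in> carrier (subgroup_generated (cube_chain_group q X) (cube_cycles q X))"
    using z by (simp add: carrier_subgroup_generated cube_cycles_def generate.incl)
  then have mem: "?BX #>\<^bsub>cube_chain_group q X\<^esub> z \<in> carrier (cube_homology_group q X)"
    by (auto simp: cube_homology_group_def FactGroup_def RCOSETS_def r_coset_def
          subgroup_generated_def)
  have "(\<Union>b\<in>?BY. (\<lambda>c. b + c) ` cube_map f ` (\<lambda>b. b + z) ` ?BX) = (\<lambda>b. b + cube_map f z) ` ?BY"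
    (is "?L = ?R")
  proof
    show "?L \<subseteq> ?R"
    proof (clarsimp simp: add)
      fix b c assume "b \<in> ?BY" "c \<in> ?BX"
      then have "b + cube_map f c \<in> ?BY" using sub img by blast
      then show "b + (cube_map f c + cube_map f z) \<in> ?R"
        by (metis add.assoc image_eqI)
    qed
    show "?R \<subseteq> ?L"
      using zero by (force simp: add zero')
  qed
  then show ?thesis using mem by (simp add: cube_induced_def coset setmult)
qed

end

theory Submission
  imports Defs
begin

text \<open>
  The map on chains is a chain map in every dimension. For a cube on which \<open>f\<close> is an embedding this
  is linear algebra. Otherwise let \<open>R\<close> be an elementary \<open>(q - 1)\<close>-cube and truncate
  the coordinates of \<open>f\<close> in the directions of \<open>R\<close> to two values. The cup product of the
  coboundaries of these functions is a cocycle; on a face of the cube it equals the sign of \<open>f\<close> if \<open>f\<close>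
  embeds the face onto a translate of \<open>R\<close> orthogonal to \<open>R\<close>, and \<open>0\<close> otherwise. If \<open>f\<close> is no
  embedding, at most one translate occurs, so the cocycle condition says that the
  signed number of faces that \<open>f\<close> maps onto \<open>R\<close> is \<open>0\<close>. Applied to the prisms
  \<open>Q \<times> [t, t + 1]\<close>, this turns a homotopy into a chain homotopy.
\<close>

section \<open>Cup products on the standard cube\<close>

text \<open>The obstacle is a folded cube: several of its faces may be mapped onto the same cube,
  and their signs have to cancel. The determinant of the edges at one vertex is no cocycle in
  general, whereas a cup product of coboundaries is one for arbitrary functions; this replaces a
  classification of the folded cubes of each dimension. What links the two is a length budget. An
  edge changes at most one coordinate, by at most 1, so the images of opposite vertices of a
  \<open>q\<close>-cube have l1-distance at most \<open>q\<close>. A nonzero cup product in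
  \<open>q\<close> directions needs a change in each of them and uses up the budget: along every
  monotone path each of these coordinates changes exactly once and nothing else moves. This rigidity
  turns the cup product into a determinant. Maps are studied on the vertices of the standard cube
  and not on cubes of \<open>X\<close>, because a prism is not a cube of \<open>X\<close>; one
  boundary formula then serves both the chain map and the chain homotopy.\<close>

text \<open>The vertices of the standard \<open>q\<close>-cube are the subsets of \<open>{..<q}\<close>, and \<open>face_vertex i e\<close> is the
  inclusion of the face on which the \<open>i\<close>-th coordinate is \<open>e\<close>.\<close>

definition face_vertex :: "nat \<Rightarrow> bool \<Rightarrow> nat set \<Rightarrow> nat set" where
  "face_vertex i e P = insert_index i ` P \<union> (if e then {i} else {})"

lemma inj_insert_index: "inj (insert_index i)"
  by (auto simp: inj_on_def insert_index_def split: if_splits)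

lemma insert_index_neq [simp]: "insert_index i j \<noteq> i" "i \<noteq> insert_index i j"
  by (auto simp: insert_index_def)

lemma insert_index_commute:
  "i \<le> j \<Longrightarrow> insert_index i (insert_index j x) = insert_index (Suc j) (insert_index i x)"
  by (auto simp: insert_index_def)

text \<open>The cubical identity for iterated faces. Inserting direction \<open>i\<close> below
  \<open>j\<close> shifts \<open>j\<close> to \<open>Suc j\<close>.\<close>

lemma face_vertex_commute:
  assumes "i \<le> j"
  shows "face_vertex i e (face_vertex j e' P) = face_vertex (Suc j) e' (face_vertex i e P)"
proof -
  have "insert_index i j = Suc j" "insert_index (Suc j) i = i"
    using assms by (auto simp: insert_index_def)
  then show ?thesis
    using assms by (auto simp: face_vertex_def image_Un image_image insert_index_commute)
qed

lemma insert_index_image_lessThan: "i \<le> q \<Longrightarrow> insert_index i ` {..<q} = {..<Suc q} - {i}"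
proof (intro equalityI subsetI)
  fix x assume i: "i \<le> q" and x: "x \<in> {..<Suc q} - {i}"
  show "x \<in> insert_index i ` {..<q}"
  proof (cases "x < i")
    case True
    with i show ?thesis by (intro image_eqI[of _ _ x]) (auto simp: insert_index_def)
  next
    case False
    with x show ?thesis by (intro image_eqI[of _ _ "x - 1"]) (auto simp: insert_index_def)
  qed
qed (auto simp: insert_index_def)

lemma face_vertex_True_lessThan: "i \<le> q \<Longrightarrow> face_vertex i True {..<q} = {..<Suc q}"
  by (auto simp: face_vertex_def insert_index_image_lessThan)

lemma face_vertex_False_lessThan: "i \<le> q \<Longrightarrow> face_vertex i False {..<q} = {..<Suc q} - {i}"
  by (auto simp: face_vertex_def insert_index_image_lessThan)

lemma face_vertex_False_simps [simp]:
  "face_vertex i False {} = {}" "face_vertex i False {c} = {insert_index i c}"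
  by (auto simp: face_vertex_def)

lemma face_vertex_subset:
  "i \<le> q \<Longrightarrow> P \<subseteq> {..<q} \<Longrightarrow> face_vertex i e P \<subseteq> {..<Suc q}"
  by (auto simp: face_vertex_def insert_index_def split: if_splits)

lemma face_vertex_mono: "P \<subseteq> P' \<Longrightarrow> face_vertex i e P \<subseteq> face_vertex i e P'"
  by (auto simp: face_vertex_def)

lemma card_face_vertex_diff:
  "card (face_vertex i e P' - face_vertex i e P) = card (P' - P)"
proof -
  have "face_vertex i e P' - face_vertex i e P = insert_index i ` (P' - P)"
    by (auto simp: face_vertex_def inj_eq[OF inj_insert_index])
  then show ?thesis
    by (simp add: card_image inj_on_subset[OF inj_insert_index])
qed

lemma face_vertex_surj:
  assumes "P \<subseteq> {..<Suc q}" "i \<le> q"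
  obtains P' where "P' \<subseteq> {..<q}" "P = face_vertex i (i \<in> P) P'"
proof
  let ?P' = "{j. insert_index i j \<in> P}"
  show "?P' \<subseteq> {..<q}"
    using assms by (auto simp: insert_index_def split: if_splits)
  have "P - {i} \<subseteq> insert_index i ` ?P'"
  proof
    fix x assume x: "x \<in> P - {i}"
    then have "x \<in> insert_index i ` {..<q}"
      using assms by (auto simp: insert_index_image_lessThan)
    then show "x \<in> insert_index i ` ?P'" using x by auto
  qed
  then show "P = face_vertex i (i \<in> P) ?P'"
    unfolding face_vertex_def by auto
qed

text \<open>The pairing behind the vanishing of a double boundary: two directions can be removed in
  either order, which gives the index pairs \<open>(i, j)\<close> and \<open>(Suc j, i)\<close> for
  \<open>i \<le> j\<close>, and their sums differ in parity.\<close>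

lemma alternating_swap_sum:
  fixes G G' :: "nat \<Rightarrow> nat \<Rightarrow> int"
  assumes "\<And>i j. i \<le> j \<Longrightarrow> j \<le> d \<Longrightarrow> G i j = G' (Suc j) i"
    and "\<And>i j. i \<le> j \<Longrightarrow> j \<le> d \<Longrightarrow> G (Suc j) i = G' i j"
  shows "(\<Sum>i\<le>Suc d. \<Sum>j\<le>d. (-1)^(i+j) * G i j) = - (\<Sum>i\<le>Suc d. \<Sum>j\<le>d. (-1)^(i+j) * G' i j)"
proof -
  let ?I = "{..Suc d} \<times> {..d}"
  let ?\<tau> = "\<lambda>(i, j). if i \<le> j then (Suc j, i) else (j, i - 1 :: nat)"
  have "(\<Sum>x\<in>?I. (-1)^(fst x + snd x) * G (fst x) (snd x)) =
        (\<Sum>x\<in>?I. - ((-1)^(fst x + snd x) * G' (fst x) (snd x)))"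
  proof (rule sum.reindex_bij_witness[of _ ?\<tau> ?\<tau>])
    fix x assume x: "x \<in> ?I"
    obtain i j where ij: "x = (i, j)" by force
    show "- ((-1)^(fst (?\<tau> x) + snd (?\<tau> x)) * G' (fst (?\<tau> x)) (snd (?\<tau> x))) =
          (-1)^(fst x + snd x) * G (fst x) (snd x)"
    proof (cases "i \<le> j")
      case True
      then show ?thesis using assms(1)[of i j] x ij by (simp add: add.commute)
    next
      case False
      then obtain k where k: "i = Suc k" "j \<le> k" by (cases i) auto
      then show ?thesis using assms(2)[of j k] x ij by (simp add: add.commute)
    qed
  qed (auto split: if_splits)
  then show ?thesis
    unfolding sum.cartesian_product by (simp only: sum_negf case_prod_unfold)
qed

text \<open>The value of \<open>dh\<^sub>0 \<union> \<dots> \<union> dh\<^sub>d\<^sub>-\<^sub>1\<close>, a cup product of cubical coboundaries, on the standard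
  \<open>d\<close>-cube, expanded along its last factor.\<close>

fun cup_form :: "nat \<Rightarrow> (nat set \<Rightarrow> nat \<Rightarrow> int) \<Rightarrow> int" where
  "cup_form 0 h = 1"
| "cup_form (Suc d) h =
     (\<Sum>i\<le>d. (-1)^(i + d) * cup_form d (\<lambda>P. h (face_vertex i False P)) *
        (h {..<Suc d} d - h ({..<Suc d} - {i}) d))"

text \<open>The cocycle property, by the Leibniz rule for the last factor. In
  \<open>cup_form\<close> the first \<open>d\<close> factors are evaluated on the front face, where
  coordinate \<open>i\<close> is 0, and the last one on the back edge in direction \<open>i\<close>,
  where all other coordinates are 1; \<open>(-1)^(i + d)\<close> is the sign of the shuffle that
  moves \<open>i\<close> behind the larger directions.\<close>

lemma cup_form_stokes:
  "(\<Sum>i\<le>q. (-1)^i * (cup_form q (\<lambda>P. h (face_vertex i True P)) -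
                      cup_form q (\<lambda>P. h (face_vertex i False P)))) = 0"
proof (induction q arbitrary: h)
  case 0
  show ?case by simp
next
  case (Suc d)
  let ?fv = face_vertex and ?T = "{..<Suc (Suc d)}"
  let ?W = "\<lambda>i e j e'. cup_form d (\<lambda>P. h (?fv i e (?fv j e' P)))"
  define GT where "GT i j = ?W i True j False * (h ?T d - h (?fv i True ({..<Suc d} - {j})) d)"
    for i j
  define GF where "GF i j = ?W i False j False * 
      (h (?T - {i}) d - h (?fv i False ({..<Suc d} - {j})) d)" for i j
  define KT where "KT i j = ?W i False j True * (h ?T d - h (?T - {i}) d)" for i j
  define KF where "KF i j = ?W i False j False * (h ?T d - h (?T - {i}) d)" for i j
  let ?S = "\<lambda>G. \<Sum>i\<le>Suc d. \<Sum>j\<le>d. (-1)^(i+j) * (G i j :: int)"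
  have top: "?fv i True ({..<Suc d} - {j}) = ?fv i True (?fv j False {..<d})"
            "?fv i False ({..<Suc d} - {j}) = ?fv i False (?fv j False {..<d})"
     if "j \<le> d" for i j
    using that by (simp_all add: face_vertex_False_lessThan)
  have low: "?T - {i} = ?fv i False (?fv j True {..<d})" if "i \<le> Suc d" "j \<le> d" for i j
    using that by (simp add: face_vertex_True_lessThan face_vertex_False_lessThan)
  have expand: "(-1)^i * cup_form (Suc d) (\<lambda>P. h (?fv i True P)) =
      (-1)^d * (\<Sum>j\<le>d. (-1)^(i+j) * GT i j)" 
      "(-1)^i * cup_form (Suc d) (\<lambda>P. h (?fv i False P)) =
      (-1)^d * (\<Sum>j\<le>d. (-1)^(i+j) * GF i j)" if "i \<le> Suc d" for i
    using that by (auto simp: GT_def GF_def sum_distrib_left face_vertex_True_lessThan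
        face_vertex_False_lessThan power_add mult_ac intro!: sum.cong)
  \<comment> \<open>Removing the two directions in the other order turns front faces of upper faces
    into upper faces of front faces.\<close>
  have GT: "?S GT = - ?S KT"
  proof (rule alternating_swap_sum)
    fix i j assume ij: "i \<le> j" "j \<le> d"
    show "GT i j = KT (Suc j) i"
      using ij by (simp add: GT_def KT_def top low[of "Suc j" i] face_vertex_commute)
    show "GT (Suc j) i = KT i j"
      using ij by (simp add: GT_def KT_def top low[of i j] face_vertex_commute)
  qed
  \<comment> \<open>The induction hypothesis on the front face: the coboundary of the first
    \<open>d\<close> factors vanishes there, and the last factor does not depend on
    \<open>j\<close>.\<close>
  have KT: "?S KT = ?S KF"
  proof (rule sum.cong[OF refl])
    fix i assume "i \<in> {..Suc d}"
    have "(\<Sum>j\<le>d. (-1)^j * (?W i False j True - ?W i False j False)) = 0"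
      using Suc.IH[of "\<lambda>P. h (?fv i False P)"] by simp
    then have *: "(\<Sum>j\<le>d. (-1)^j * ?W i False j True) = (\<Sum>j\<le>d. (-1)^j * ?W i False j False)"
      by (simp add: right_diff_distrib sum_subtractf)
    have "(\<Sum>j\<le>d. (-1)^(i+j) * KT i j) =
        (-1)^i * (h ?T d - h (?T - {i}) d) * (\<Sum>j\<le>d. (-1)^j * ?W i False j True)"
      by (simp add: KT_def sum_distrib_left power_add mult_ac)
    also have "\<dots> = (-1)^i * (h ?T d - h (?T - {i}) d) * (\<Sum>j\<le>d. (-1)^j * ?W i False j False)"
      using * by simp
    also have "\<dots> = (\<Sum>j\<le>d. (-1)^(i+j) * KF i j)"
      by (simp add: KF_def sum_distrib_left power_add mult_ac)
    finally show "(\<Sum>j\<le>d. (-1)^(i+j) * KT i j) = (\<Sum>j\<le>d. (-1)^(i+j) * KF i j)" .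
  qed
  \<comment> \<open>The two increments of the last function telescope to one between the top vertex
    and the vertex that lacks both directions. This is symmetric in the directions, so the
    alternating sum equals its own negative: the double coboundary of a function vanishes.\<close>
  define L where "L i j = KF i j + GF i j" for i j
  have "?S L = - ?S L"
  proof (rule alternating_swap_sum)
    fix i j assume ij: "i \<le> j" "j \<le> d"
    have "L i j = ?W i False j False * (h ?T d - h (?fv i False (?fv j False {..<d})) d)"
      if "j \<le> d" for i j
      using that by (simp add: L_def KF_def GF_def top right_diff_distrib)
    with ij show "L i j = L (Suc j) i" "L (Suc j) i = L i j"
      by (simp_all add: face_vertex_commute)
  qed
  then have "?S KF + ?S GF = 0"
    by (simp add: L_def distrib_left sum.distrib)
  moreover have "(\<Sum>i\<le>Suc d. (-1)^i * (cup_form (Suc d) (\<lambda>P. h (?fv i True P)) -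
        cup_form (Suc d) (\<lambda>P. h (?fv i False P)))) = (-1)^d * (?S GT - ?S GF)"
  proof -
    have "(\<Sum>i\<le>Suc d. (-1)^i * (cup_form (Suc d) (\<lambda>P. h (?fv i True P)) -
        cup_form (Suc d) (\<lambda>P. h (?fv i False P)))) =
       (\<Sum>i\<le>Suc d. (-1)^d * (\<Sum>j\<le>d. (-1)^(i+j) * GT i j) - (-1)^d * (\<Sum>j\<le>d. (-1)^(i+j) * GF i j))"
      by (rule sum.cong[OF refl]) (simp only: right_diff_distrib expand atMost_iff)
    also have "\<dots> = (-1)^d * (?S GT - ?S GF)"
      by (simp only: sum_subtractf sum_distrib_left[symmetric] right_diff_distrib)
    finally show ?thesis .
  qed
  ultimately show ?case using GT KT by simp
qed

section \<open>Rigidity of extremal 1-Lipschitz maps on the standard cube\<close>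

definition cube_lipschitz :: "nat \<Rightarrow> nat \<Rightarrow> (nat set \<Rightarrow> nat \<Rightarrow> int) \<Rightarrow> bool" where
  "cube_lipschitz n q h \<longleftrightarrow>
     (\<forall>P P'. P \<subseteq> P' \<longrightarrow> P' \<subseteq> {..<q} \<longrightarrow> (\<Sum>r<n. \<bar>h P' r - h P r\<bar>) \<le> int (card (P' - P)))"

text \<open>The extremal case of the Lipschitz bound: the whole length \<open>d\<close> is needed to
  change the \<open>d\<close> coordinates.\<close>

definition antipodal :: "nat \<Rightarrow> (nat set \<Rightarrow> nat \<Rightarrow> int) \<Rightarrow> bool" where
  "antipodal d h \<longleftrightarrow> (\<forall>r<d. \<bar>h {..<d} r - h {} r\<bar> = 1)"

definition moved :: "nat \<Rightarrow> (nat set \<Rightarrow> nat \<Rightarrow> int) \<Rightarrow> nat set \<Rightarrow> nat set" where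
  "moved d h P = {r. r < d \<and> h P r \<noteq> h {} r}"

definition edge_matrix :: "nat \<Rightarrow> (nat set \<Rightarrow> nat \<Rightarrow> int) \<Rightarrow> int mat" where
  "edge_matrix d h = mat d d (\<lambda>(r, c). h {c} r - h {} r)"

lemma cube_lipschitzD:
  "cube_lipschitz n q h \<Longrightarrow> P \<subseteq> P' \<Longrightarrow> P' \<subseteq> {..<q} \<Longrightarrow>
     (\<Sum>r<n. \<bar>h P' r - h P r\<bar>) \<le> int (card (P' - P))"
  by (auto simp: cube_lipschitz_def)

lemma cube_lipschitz_face:
  assumes "cube_lipschitz n (Suc q) h" "i \<le> q" "n' \<le> n"
  shows "cube_lipschitz n' q (\<lambda>P. h (face_vertex i e P))"
  unfolding cube_lipschitz_def
proof (intro allI impI)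
  fix P P' :: "nat set" assume P: "P \<subseteq> P'" "P' \<subseteq> {..<q}"
  have "(\<Sum>r<n'. \<bar>h (face_vertex i e P') r - h (face_vertex i e P) r\<bar>) \<le>
      (\<Sum>r<n. \<bar>h (face_vertex i e P') r - h (face_vertex i e P) r\<bar>)"
    using assms(3) by (intro sum_mono2) auto
  also have "\<dots> \<le> int (card (face_vertex i e P' - face_vertex i e P))"
    using P assms by (intro cube_lipschitzD[OF assms(1)] face_vertex_mono face_vertex_subset)
  finally show "(\<Sum>r<n'. \<bar>h (face_vertex i e P') r - h (face_vertex i e P) r\<bar>) \<le> int (card (P' - P))"
    by (simp add: card_face_vertex_diff)
qed

text \<open>Each of the \<open>d\<close> coordinates travels at least 1 on the way from the bottom
  over \<open>P\<close> and \<open>P'\<close> to the top, while the Lipschitz bounds of the three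
  stretches add up to \<open>d\<close>. So all these inequalities are equalities.\<close>

lemma antipodal_path:
  assumes L: "cube_lipschitz d d h" and A: "antipodal d h" and P: "P \<subseteq> P'" "P' \<subseteq> {..<d}"
  shows "r < d \<Longrightarrow> \<bar>h P r - h {} r\<bar> + \<bar>h P' r - h P r\<bar> + \<bar>h {..<d} r - h P' r\<bar> = 1"
    and "(\<Sum>r<d. \<bar>h P r - h {} r\<bar>) = int (card P)"
proof -
  let ?t = "\<lambda>r. \<bar>h P r - h {} r\<bar> + \<bar>h P' r - h P r\<bar> + \<bar>h {..<d} r - h P' r\<bar>"
  have fin: "finite P'" using P finite_subset by blast
  have 1: "(\<Sum>r<d. \<bar>h P r - h {} r\<bar>) \<le> int (card P)"
    using cube_lipschitzD[OF L, of "{}" P] P by auto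
  have 2: "(\<Sum>r<d. \<bar>h P' r - h P r\<bar>) \<le> int (card P') - int (card P)"
    using cube_lipschitzD[OF L P] card_Diff_subset[OF finite_subset[OF P(1) fin] P(1)]
      card_mono[OF fin P(1)] by simp
  have 3: "(\<Sum>r<d. \<bar>h {..<d} r - h P' r\<bar>) \<le> int d - int (card P')"
    using cube_lipschitzD[OF L P(2)] card_Diff_subset[OF fin P(2)] card_mono[OF _ P(2)] by simp
  have ge: "0 \<le> ?t r - 1" if "r < d" for r
  proof -
    have "\<bar>h {..<d} r - h {} r\<bar> = 1" using A that by (simp add: antipodal_def)
    then show ?thesis by linarith
  qed
  have tot: "(\<Sum>r<d. ?t r) \<le> int d"
    using 1 2 3 by (simp add: sum.distrib)
  have le: "(\<Sum>r<d. ?t r - 1) \<le> 0"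
    using tot by (simp add: sum_subtractf)
  have ge0: "(\<Sum>r<d. ?t r - 1) \<ge> 0"
    by (rule sum_nonneg) (use ge in auto)
  then have "(\<Sum>r<d. ?t r - 1) = 0" using le by linarith
  moreover have "(\<Sum>r<d. ?t r - 1) = 0 \<longleftrightarrow> (\<forall>r\<in>{..<d}. ?t r - 1 = 0)"
    by (rule sum_nonneg_eq_0_iff) (use ge in auto)
  ultimately show "?t r = 1" if "r < d" using that by auto
  have "(\<Sum>r<d. ?t r) \<ge> int d"
    using ge0 by (simp add: sum_subtractf)
  then show "(\<Sum>r<d. \<bar>h P r - h {} r\<bar>) = int (card P)"
    using 1 2 3 by (simp add: sum.distrib)
qed

lemma moved_subset: "moved d h P \<subseteq> {..<d}"
  by (auto simp: moved_def)

lemma moved_mono: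
  assumes "cube_lipschitz d d h" "antipodal d h" "P \<subseteq> P'" "P' \<subseteq> {..<d}"
  shows "moved d h P \<subseteq> moved d h P'"
proof
  fix r assume "r \<in> moved d h P"
  then have r: "r < d" "h P r \<noteq> h {} r" by (auto simp: moved_def)
  have "\<bar>h P r - h {} r\<bar> + \<bar>h P' r - h P r\<bar> + \<bar>h {..<d} r - h P' r\<bar> = 1"
    using antipodal_path(1)[OF assms r(1)] .
  then show "r \<in> moved d h P'" using r by (auto simp: moved_def)
qed

lemma moved_value:
  assumes "cube_lipschitz d d h" "antipodal d h" "P \<subseteq> {..<d}" "r < d"
  shows "h P r = h {} r + (if r \<in> moved d h P then h {..<d} r - h {} r else 0)"
  using antipodal_path(1)[OF assms(1,2) order.refl assms(3,4)] assms(4)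
  by (auto simp: moved_def)

lemma card_moved:
  assumes "cube_lipschitz d d h" "antipodal d h" "P \<subseteq> {..<d}"
  shows "card (moved d h P) = card P"
proof -
  have "\<bar>h P r - h {} r\<bar> = (if r \<in> moved d h P then 1 else 0)" if "r < d" for r
    using antipodal_path(1)[OF assms(1,2) order.refl assms(3) that] that
    by (auto simp: moved_def)
  then have "(\<Sum>r<d. \<bar>h P r - h {} r\<bar>) = (\<Sum>r<d. if r \<in> moved d h P then 1 else 0)"
    by (intro sum.cong) auto
  also have "\<dots> = int (card (moved d h P))"
    using moved_subset[of d h P] by (simp add: sum.If_cases Int_absorb1)
  finally show ?thesis
    using antipodal_path(2)[OF assms(1,2) order.refl assms(3)] by simp
qed

text \<open>The function \<open>a\<close> names the coordinate that the edge in direction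
  \<open>c\<close> changes at the bottom vertex. It becomes the permutation of the directions as
  soon as it is injective.\<close>

lemma moved_singleton:
  assumes "cube_lipschitz d d h" "antipodal d h"
  obtains a where "a \<in> {..<d} \<rightarrow> {..<d}" "\<And>c. c < d \<Longrightarrow> moved d h {c} = {a c}"
proof -
  have "\<exists>x. moved d h {c} = {x}" if "c < d" for c
    using card_moved[OF assms, of "{c}"] that by (auto simp: card_1_singleton_iff)
  then obtain a where a: "\<And>c. c < d \<Longrightarrow> moved d h {c} = {a c}" by metis
  then have "a \<in> {..<d} \<rightarrow> {..<d}" using moved_subset[of d h] by fastforce
  with a show ?thesis using that by blast
qed

lemma moved_supset_image:
  assumes "cube_lipschitz d d h" "antipodal d h" "P \<subseteq> {..<d}"
    and a: "\<And>c. c < d \<Longrightarrow> moved d h {c} = {a c}"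
  shows "a ` P \<subseteq> moved d h P"
proof
  fix x assume "x \<in> a ` P"
  then obtain c where c: "c \<in> P" "x = a c" by blast
  then have "c < d" using assms(3) by auto
  then show "x \<in> moved d h P"
    using moved_mono[OF assms(1,2), of "{c}" P] assms(3) c a by auto
qed

lemma moved_eq_image:
  assumes "cube_lipschitz d d h" "antipodal d h" "P \<subseteq> {..<d}"
    and a: "\<And>c. c < d \<Longrightarrow> moved d h {c} = {a c}" and inj: "inj_on a P"
  shows "moved d h P = a ` P"
proof (rule card_subset_eq[symmetric])
  show "finite (moved d h P)" by (rule finite_subset[OF moved_subset]) simp
  show "a ` P \<subseteq> moved d h P" by (rule moved_supset_image[OF assms(1-3) a])
  show "card (a ` P) = card (moved d h P)"
    using card_image[OF inj] card_moved[OF assms(1-3)] by simp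
qed

section \<open>The cup product as a determinant\<close>

lemma edge_matrix_carrier [simp]: "edge_matrix d h \<in> carrier_mat d d"
  by (simp add: edge_matrix_def)

lemma edge_matrix_index:
  assumes "cube_lipschitz d d h" "antipodal d h" "r < d" "c < d"
    and a: "\<And>c. c < d \<Longrightarrow> moved d h {c} = {a c}"
  shows "edge_matrix d h $$ (r, c) = (if r = a c then h {..<d} r - h {} r else 0)"
  using moved_value[OF assms(1,2), of "{c}" r] assms by (auto simp: edge_matrix_def)

lemma mat_delete_edge_matrix:
  "j \<le> d \<Longrightarrow> mat_delete (edge_matrix (Suc d) h) d j =
     edge_matrix d (\<lambda>P. h (face_vertex j False P))"
  by (auto simp: mat_delete_def edge_matrix_def insert_index_def intro!: eq_matI)

lemma mat_delete_cong_row: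
  assumes "A \<in> carrier_mat n n'" "B \<in> carrier_mat n n'" 
    and "\<And>r c. r < n \<Longrightarrow> c < n' \<Longrightarrow> r \<noteq> i \<Longrightarrow> A $$ (r, c) = B $$ (r, c)"
  shows "mat_delete A i j = mat_delete B i j"
  using assms by (auto simp: mat_delete_def intro!: eq_matI)

text \<open>Expanding the cup product along its last factor gives \<open>det N\<close>, where \<open>N\<close> is the edge matrix
  with its last row replaced by the increments of \<open>h\<close> into the top vertex. The two matrices agree
  when the single edges move distinct coordinates; otherwise both determinants vanish, because
  of two equal columns or because all relevant minors along the last row do.\<close>

lemma cup_form_eq_det:
  assumes "cube_lipschitz d d h" "antipodal d h"
  shows "cup_form d h = det (edge_matrix d h)"
  using assms
proof (induction d arbitrary: h)
  case 0
  show ?case by (simp add: edge_matrix_def)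
next
  case (Suc d)
  note L = Suc.prems(1) and A = Suc.prems(2)
  let ?m = "moved (Suc d) h" and ?T = "{..<Suc d}" and ?M = "edge_matrix (Suc d) h"
  let ?\<Delta> = "\<lambda>i. h ?T d - h (?T - {i}) d"
  obtain a where a_mem: "a \<in> ?T \<rightarrow> ?T" and a: "\<And>c. c < Suc d \<Longrightarrow> ?m {c} = {a c}"
    using moved_singleton[OF L A] by blast
  have \<Delta>: "?\<Delta> i = (if d \<in> ?m (?T - {i}) then 0 else h ?T d - h {} d)" for i
    using moved_value[OF L A, of "?T - {i}" d] by auto
  \<comment> \<open>A nonzero increment means that coordinate \<open>d\<close> changes only on the
    last edge, so the \<open>d\<close> edges before it have changed all the others.\<close>
  have full: "?m (?T - {i}) = {..<d}" if "?\<Delta> i \<noteq> 0" "i \<le> d" for i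
  proof (rule card_subset_eq)
    have "?m (?T - {i}) \<subseteq> ?T" by (rule moved_subset)
    moreover have "d \<notin> ?m (?T - {i})" using that \<Delta> by (auto split: if_splits)
    ultimately show "?m (?T - {i}) \<subseteq> {..<d}" by (auto simp: less_Suc_eq)
    show "card (?m (?T - {i})) = card {..<d}"
      using card_moved[OF L A, of "?T - {i}"] that by simp
  qed simp
  have face: "cup_form d (\<lambda>P. h (face_vertex i False P)) = det (mat_delete ?M d i)"
    if i: "?\<Delta> i \<noteq> 0" "i \<le> d" for i
  proof -
    have "antipodal d (\<lambda>P. h (face_vertex i False P))"
      unfolding antipodal_def
    proof (intro allI impI)
      fix r assume r: "r < d"
      have "h (?T - {i}) r = h ?T r"
        using moved_value[OF L A, of "?T - {i}" r] full[OF i] r by auto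
      then show "\<bar>h (face_vertex i False {..<d}) r - h (face_vertex i False {}) r\<bar> = 1"
        using A r i by (simp add: antipodal_def face_vertex_False_lessThan)
    qed
    then show ?thesis
      using Suc.IH cube_lipschitz_face[OF L i(2), of d] mat_delete_edge_matrix[OF i(2)] by simp
  qed
  define N where
    "N = mat (Suc d) (Suc d) (\<lambda>(r, c). if r = d then ?\<Delta> c else ?M $$ (r, c))"
  have N: "N \<in> carrier_mat (Suc d) (Suc d)" by (simp add: N_def)
  have del: "mat_delete N d j = mat_delete ?M d j" for j
    by (rule mat_delete_cong_row[OF N edge_matrix_carrier]) (auto simp: N_def)
  have det_N: "det N = (\<Sum>j<Suc d. N $$ (d, j) * cofactor N d j)"
    by (rule laplace_expansion_row[OF N]) simp
  have "cup_form (Suc d) h = (\<Sum>j\<le>d. ?\<Delta> j * ((-1)^(d+j) * det (mat_delete ?M d j)))"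
    unfolding cup_form.simps
  proof (rule sum.cong[OF refl])
    fix i assume "i \<in> {..d}"
    then show "(-1)^(i + d) * cup_form d (\<lambda>P. h (face_vertex i False P)) * ?\<Delta> i =
        ?\<Delta> i * ((-1)^(d+i) * det (mat_delete ?M d i))"
      using face[of i] by (cases "?\<Delta> i = 0") (simp_all add: add.commute)
  qed
  also have "\<dots> = det N"
    unfolding det_N cofactor_def del
    by (intro sum.cong) (auto simp: N_def)
  finally have cup: "cup_form (Suc d) h = det N" .
  have entry: "?M $$ (r, c) = (if r = a c then h ?T r - h {} r else 0)" if "r \<le> d" "c \<le> d" for r c
    using edge_matrix_index[OF L A _ _ a] that by simp
  show ?case
  proof (cases "inj_on a ?T")
    case True
    have "N = ?M"
    proof (rule eq_matI)
      fix r c assume "r < dim_row ?M" "c < dim_col ?M"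
      then have rc: "r \<le> d" "c \<le> d" by (auto simp: edge_matrix_def)
      have aT: "a ` ?T = ?T"
        using True a_mem by (intro card_subset_eq) (auto simp: card_image)
      \<comment> \<open>For injective \<open>a\<close> the edge in direction \<open>c\<close> into
        the top vertex moves the same coordinate \<open>a c\<close> as the parallel edge at the
        bottom.\<close>
      have "?m (?T - {c}) = a ` (?T - {c})"
        by (rule moved_eq_image[OF L A _ a]) (use True in \<open>auto intro: inj_on_subset\<close>)
      also have "\<dots> = ?T - {a c}"
        using inj_on_image_set_diff[OF True, of ?T "{c}"] aT rc by auto
      finally have "d \<in> ?m (?T - {c}) \<longleftrightarrow> d \<noteq> a c" by auto
      then have "?\<Delta> c = (if d = a c then h ?T d - h {} d else 0)"
        unfolding \<Delta>[of c] by simp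
      moreover have "N $$ (r, c) = (if r = d then ?\<Delta> c else ?M $$ (r, c))"
        using rc by (simp add: N_def)
      ultimately show "N $$ (r, c) = ?M $$ (r, c)"
        using entry[OF rc] by metis
    qed (simp_all add: N_def edge_matrix_def)
    with cup show ?thesis by simp
  next
    case False
    then obtain c c' where c: "c \<le> d" "c' \<le> d" "c \<noteq> c'" "a c = a c'"
      unfolding inj_on_def by (metis lessThan_iff less_Suc_eq_le)
    have "det ?M = 0"
      by (rule det_identical_columns[of _ "Suc d" c c'])
         (use c entry in \<open>auto simp: edge_matrix_def intro!: eq_vecI\<close>)
    \<comment> \<open>A nonzero term \<open>j\<close> of the expansion along the last row makes
      \<open>a\<close> a bijection from the directions other than \<open>j\<close> onto
      \<open>{..<d}\<close>. As \<open>a\<close> is not injective, \<open>a j\<close> equals some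
      \<open>a i\<close>, and exchanging \<open>i\<close> and \<open>j\<close> keeps the image.
      Hence columns \<open>i\<close> and \<open>j\<close> of \<open>N\<close> agree, also in the
      last row.\<close>
    moreover have "det N = 0"
    proof (rule ccontr)
      assume "det N \<noteq> 0"
      then obtain j where j: "j \<le> d" "N $$ (d, j) * cofactor N d j \<noteq> 0"
        unfolding det_N by (metis (mono_tags, lifting) lessThan_iff less_Suc_eq_le sum.neutral)
      then have \<Delta>j: "?\<Delta> j \<noteq> 0" and minor: "det (mat_delete ?M d j) \<noteq> 0"
        by (auto simp: N_def cofactor_def del[unfolded N_def])
      have low: "a i < d" if "i \<le> d" "i \<noteq> j" for i
      proof -
        have "a ` (?T - {j}) \<subseteq> {..<d}"
          using moved_supset_image[OF L A, of "?T - {j}", OF _ a] full[OF \<Delta>j j(1)] by auto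
        moreover have "i \<in> ?T - {j}" using that by simp
        ultimately show ?thesis by blast
      qed
      have inj: "inj_on a (?T - {j})"
      proof (rule ccontr)
        assume "\<not> inj_on a (?T - {j})"
        then obtain x y where xy: "x \<in> ?T - {j}" "y \<in> ?T - {j}" "x \<noteq> y" "a x = a y"
          by (auto simp: inj_on_def)
        obtain x' y' where x': "x = insert_index j x'" "x' < d" and y': "y = insert_index j y'" "y' < d"
          using xy insert_index_image_lessThan[OF j(1)] by (metis imageE lessThan_iff)
        have "det (edge_matrix d (\<lambda>P. h (face_vertex j False P))) = 0"
          by (rule det_identical_columns[of _ d x' y'])
            (use xy x' y' entry[of _ x] entry[of _ y] in
              \<open>auto simp: edge_matrix_def intro!: eq_vecI\<close>)
        with minor show False using mat_delete_edge_matrix[OF j(1)] by simp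
      qed
      have im: "a ` (?T - {j}) = {..<d}"
      proof (rule card_subset_eq)
        show "a ` (?T - {j}) \<subseteq> {..<d}" by (auto simp: less_Suc_eq_le intro!: low)
        show "card (a ` (?T - {j})) = card {..<d}" using j(1) by (simp add: card_image[OF inj])
      qed simp
      have "a j < d"
      proof (rule ccontr)
        assume "\<not> a j < d"
        then have "inj_on a (insert j (?T - {j}))"
          unfolding inj_on_insert Diff_idemp im using inj by simp
        then have "inj_on a ?T" using j(1) by (simp add: insert_absorb)
        with False show False ..
      qed
      then obtain i where i: "i \<in> ?T - {j}" "a i = a j"
        using im by (metis imageE lessThan_iff)
      have "a ` (?T - {i}) = {..<d}"
      proof -
        have "a ` (?T - {i}) \<supseteq> {..<d}"
        proof
          fix x assume "x \<in> {..<d}"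
          then obtain k where k: "k \<in> ?T - {j}" "x = a k" using im by blast
          then show "x \<in> a ` (?T - {i})"
            using i j by (cases "k = i") (auto intro!: image_eqI[of _ _ j])
        qed
        moreover have "a ` (?T - {i}) \<subseteq> {..<d}"
        proof
          fix x assume "x \<in> a ` (?T - {i})"
          then obtain k where "k \<in> ?T - {i}" "x = a k" by blast
          then show "x \<in> {..<d}"
            using low[of k] \<open>a j < d\<close> by (cases "k = j") auto
        qed
        ultimately show ?thesis by blast
      qed
      then have "{..<d} \<subseteq> ?m (?T - {i})"
        using moved_supset_image[OF L A, of "?T - {i}", OF _ a] by auto
      moreover have "card (?m (?T - {i})) = card {..<d}"
        using card_moved[OF L A, of "?T - {i}"] i by simp
      ultimately have "?m (?T - {i}) = {..<d}"
        using moved_subset[of "Suc d" h] by (metis card_subset_eq finite_lessThan finite_subset)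
      then have "?\<Delta> i = ?\<Delta> j"
        using \<Delta>[of i] \<Delta>[of j] full[OF \<Delta>j j(1)] by simp
      then have "det N = 0"
        by (intro det_identical_columns[of _ "Suc d" i j])
          (use i j entry in \<open>auto simp: N_def less_Suc_eq_le intro!: eq_vecI\<close>)
      with \<open>det N \<noteq> 0\<close> show False ..
    qed
    ultimately show ?thesis using cup by simp
  qed
qed

text \<open>Take a nonzero term of the expansion. By induction the front face spends its whole
  length on the first \<open>d\<close> coordinates, so coordinate \<open>d\<close> agrees at its two
  extreme vertices; the final edge then spends its single unit on coordinate
  \<open>d\<close>.\<close>

lemma cup_form_nonzero_antipodal:
  assumes "cube_lipschitz d d h" "cup_form d h \<noteq> 0"
  shows "antipodal d h"
  using assms
proof (induction d arbitrary: h)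
  case 0
  show ?case by (simp add: antipodal_def)
next
  case (Suc d)
  let ?T = "{..<Suc d}"
  obtain i where i: "i \<le> d" "cup_form d (\<lambda>P. h (face_vertex i False P)) \<noteq> 0"
      "h ?T d \<noteq> h (?T - {i}) d"
    using Suc.prems(2) unfolding cup_form.simps
    by (metis (no_types, lifting) atMost_iff mult_eq_0_iff right_minus_eq sum.neutral)
  have "antipodal d (\<lambda>P. h (face_vertex i False P))"
    using Suc.IH[OF cube_lipschitz_face[OF Suc.prems(1) i(1)] i(2)] by simp
  then have far: "\<bar>h (?T - {i}) r - h {} r\<bar> = 1" if "r < d" for r
    using that i by (simp add: antipodal_def face_vertex_False_lessThan)
  have "(\<Sum>r<Suc d. \<bar>h (?T - {i}) r - h {} r\<bar>) \<le> int (card (?T - {i} - {}))"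
    by (rule cube_lipschitzD[OF Suc.prems(1)]) auto
  then have d: "h (?T - {i}) d = h {} d"
    using far i by simp
  have "(\<Sum>r<Suc d. \<bar>h ?T r - h (?T - {i}) r\<bar>) \<le> int (card (?T - (?T - {i})))"
    by (rule cube_lipschitzD[OF Suc.prems(1)]) auto
  moreover have "?T - (?T - {i}) = {i}" using i by auto
  ultimately have le1: "(\<Sum>r<d. \<bar>h ?T r - h (?T - {i}) r\<bar>) + \<bar>h ?T d - h (?T - {i}) d\<bar> \<le> 1"
    by simp
  moreover have nn: "(\<Sum>r<d. \<bar>h ?T r - h (?T - {i}) r\<bar>) \<ge> 0" by (simp add: sum_nonneg)
  ultimately have "(\<Sum>r<d. \<bar>h ?T r - h (?T - {i}) r\<bar>) = 0" "\<bar>h ?T d - h (?T - {i}) d\<bar> = 1"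
    using i(3) by linarith+
  moreover from this(1) have "h ?T r = h (?T - {i}) r" if "r < d" for r
    using that by (simp add: sum_nonneg_eq_0_iff)
  ultimately show ?case
    using far d by (auto simp: antipodal_def less_Suc_eq)
qed

text \<open>Column \<open>c\<close> of the edge matrix has its only nonzero entry in row
  \<open>a c\<close>, with a value that depends on the row alone; equal values of \<open>a\<close>
  give equal columns.\<close>

lemma antipodal_det_nonzero_inj:
  assumes L: "cube_lipschitz d d h" and A: "antipodal d h" and "det (edge_matrix d h) \<noteq> 0"
    and a: "\<And>c. c < d \<Longrightarrow> moved d h {c} = {a c}"
  shows "inj_on a {..<d}"
proof (rule ccontr)
  assume "\<not> inj_on a {..<d}"
  then obtain c c' where c: "c < d" "c' < d" "c \<noteq> c'" "a c = a c'"
    by (auto simp: inj_on_def)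
  have "det (edge_matrix d h) = 0"
    by (rule det_identical_columns[of _ d c c'])
      (use c edge_matrix_index[OF L A _ _ a] in \<open>auto simp: edge_matrix_def intro!: eq_vecI\<close>)
  with assms(3) show False ..
qed

section \<open>Elementary cubes and singular cubes\<close>

definition cube :: "int list \<Rightarrow> nat list \<Rightarrow> int list set" where
  "cube v js = listset (map (\<lambda>i. if i \<in> set js then {v ! i, v ! i + 1} else {v ! i}) [0..<length v])"

text \<open>Sortedness makes the presentation unique: \<open>js\<close> is then the list
  \<open>nondeg_dirs\<close> of the cube.\<close>

definition frame :: "int list \<Rightarrow> nat list \<Rightarrow> bool" where
  "frame v js \<longleftrightarrow> sorted_wrt (<) js \<and> set js \<subseteq> {..<length v}"

definition del :: "nat \<Rightarrow> 'a list \<Rightarrow> 'a list" where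
  "del i xs = take i xs @ drop (Suc i) xs"

lemma frame_distinct: "frame v js \<Longrightarrow> distinct js"
  using strict_sorted_iff[of js] by (auto simp: frame_def)

lemma frame_nth_less: "frame v js \<Longrightarrow> r < length js \<Longrightarrow> js ! r < length v"
  unfolding frame_def by (meson lessThan_iff nth_mem subsetD)

lemma length_del: "i < length xs \<Longrightarrow> length (del i xs) = length xs - 1"
  by (auto simp: del_def)

lemma nth_del: "i < length xs \<Longrightarrow> r < length xs - 1 \<Longrightarrow> del i xs ! r = xs ! insert_index i r"
  by (auto simp: del_def insert_index_def nth_append min_def)

lemma set_del: "distinct xs \<Longrightarrow> i < length xs \<Longrightarrow> set (del i xs) = set xs - {xs ! i}"
proof -
  assume d: "distinct xs" and i: "i < length xs"
  have "xs = take i xs @ xs ! i # drop (Suc i) xs" using i by (rule id_take_nth_drop)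
  moreover have "set ys - {x} = set (as @ bs)" if "distinct ys" "ys = as @ x # bs" for ys as bs x
    using that by auto
  ultimately show ?thesis using d unfolding del_def by metis
qed

lemma frame_del:
  assumes "frame v js" "i < length js" "length v' = length v"
  shows "frame v' (del i js)"
proof -
  have "sorted_wrt (<) (take i js @ js ! i # drop (Suc i) js)"
    using assms id_take_nth_drop[of i js] by (simp add: frame_def)
  then show ?thesis
    using assms set_del[OF frame_distinct[OF assms(1)] assms(2)]
    by (auto simp: frame_def del_def sorted_wrt_append)
qed

lemma mem_listset_iff: "x \<in> listset Js \<longleftrightarrow> length x = length Js \<and> (\<forall>i<length Js. x ! i \<in> Js ! i)"
proof (induction Js arbitrary: x)
  case (Cons J Js)
  show ?case
    by (cases x) (auto simp: set_Cons_def Cons.IH less_Suc_eq_0_disj)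
qed simp

lemma mem_cube_iff:
  "x \<in> cube v js \<longleftrightarrow> length x = length v \<and>
     (\<forall>i<length v. x ! i = v ! i \<or> i \<in> set js \<and> x ! i = v ! i + 1)"
  by (auto simp: cube_def mem_listset_iff)

lemma factors_cube:
  "factors (cube v js) = map (\<lambda>i. if i \<in> set js then {v ! i, v ! i + 1} else {v ! i}) [0..<length v]"
  unfolding cube_def by (rule factors_listset) (auto simp: elementary_interval_def)

lemma nth_factors_cube:
  "i < length v \<Longrightarrow> factors (cube v js) ! i = (if i \<in> set js then {v ! i, v ! i + 1} else {v ! i})"
  by (simp add: factors_cube)

lemma length_factors_cube [simp]: "length (factors (cube v js)) = length v"
  by (simp add: factors_cube)

lemma listset_factors_cube: "listset (factors (cube v js)) = cube v js"
  unfolding factors_cube by (simp add: cube_def)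

lemma elementary_cube_cube: "elementary_cube (cube v js)"
  unfolding elementary_cube_def cube_def
  by (intro exI conjI, rule_tac [2] refl) (auto simp: elementary_interval_def)

lemma not_nondegenerate_singleton: "\<not> nondegenerate {x}"
proof
  assume "nondegenerate {x}"
  then obtain b where "{x} = {b, b + 1}" unfolding nondegenerate_def by blast
  then have "b \<in> {x}" "b + 1 \<in> {x}" by auto
  then show False by simp
qed

lemma nondeg_dirs_cube:
  assumes "frame v js"
  shows "nondeg_dirs (cube v js) = js"
proof -
  have *: "nondegenerate {x, x + 1}" for x by (auto simp: nondegenerate_def)
  have "nondeg_dirs (cube v js) = filter (\<lambda>i. i \<in> set js) [0..<length v]"
    unfolding nondeg_dirs_def length_factors_cube
    by (rule filter_cong) (auto simp: nth_factors_cube * not_nondegenerate_singleton)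
  also have "\<dots> = js"
    using assms by (intro strict_sorted_equal) (auto simp: frame_def sorted_wrt_filter)
  finally show ?thesis .
qed

lemma cube_dim_cube: "frame v js \<Longrightarrow> cube_dim (cube v js) = length js"
  by (simp add: cube_dim_def nondeg_dirs_cube)

lemma elementary_cubeE:
  assumes "elementary_cube Q"
  obtains v js where "frame v js" "Q = cube v js"
proof -
  obtain Js where Js: "\<forall>J\<in>set Js. elementary_interval J" "Q = listset Js"
    using assms by (auto simp: elementary_cube_def)
  define v where "v = map Min Js"
  define js where "js = filter (\<lambda>i. nondegenerate (Js ! i)) [0..<length Js]"
  have "frame v js"
    by (auto simp: frame_def js_def v_def sorted_wrt_filter)
  have "Js = map (\<lambda>i. if i \<in> set js then {v ! i, v ! i + 1} else {v ! i}) [0..<length v]"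
  proof (rule nth_equalityI)
    fix i assume i: "i < length Js"
    then have "elementary_interval (Js ! i)" using Js by simp
    then obtain x where x: "Js ! i = {x} \<or> Js ! i = {x, x + 1}"
      unfolding elementary_interval_def by blast
    have "i \<in> set js \<longleftrightarrow> nondegenerate (Js ! i)" "v ! i = Min (Js ! i)"
      using i by (simp_all add: js_def v_def)
    moreover have "nondegenerate {x, x + 1}" by (auto simp: nondegenerate_def)
    ultimately show "Js ! i = map (\<lambda>i. if i \<in> set js then {v ! i, v ! i + 1} else {v ! i}) [0..<length v] ! i"
      using i x not_nondegenerate_singleton[of x] by (elim disjE) (simp_all add: v_def)
  qed (simp add: v_def)
  then have "Q = cube v js" unfolding Js(2) cube_def by (rule arg_cong)
  with \<open>frame v js\<close> show ?thesis using that by blast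
qed

lemma lower_face_cube:
  assumes "frame v js" "i < length js"
  shows "lower_face (js ! i) (cube v js) = cube v (del i js)"
proof -
  have i: "js ! i < length v" using frame_nth_less[OF assms] .
  have "(factors (cube v js))[js ! i := {Min (factors (cube v js) ! (js ! i))}] = factors (cube v (del i js))"
    by (rule nth_equalityI)
      (use assms i in \<open>auto simp: nth_list_update nth_factors_cube set_del[OF frame_distinct]\<close>)
  then show ?thesis
    unfolding lower_face_def by (simp add: listset_factors_cube)
qed

lemma upper_face_cube:
  assumes "frame v js" "i < length js"
  shows "upper_face (js ! i) (cube v js) = cube (v[js ! i := v ! (js ! i) + 1]) (del i js)"
proof -
  have i: "js ! i < length v" using frame_nth_less[OF assms] .
  have "(factors (cube v js))[js ! i := {Max (factors (cube v js) ! (js ! i))}] = factors (cube (v[js ! i := v ! (js ! i) + 1]) (del i js))"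
    by (rule nth_equalityI)
      (use assms i in \<open>auto simp: nth_list_update nth_factors_cube set_del[OF frame_distinct]\<close>)
  then show ?thesis
    unfolding upper_face_def by (simp add: listset_factors_cube)
qed

text \<open>\<open>U\<close> consists of positions in \<open>js\<close> and not of lattice
  coordinates, so that all \<open>q\<close>-cubes share the vertex set \<open>Pow {..<q}\<close> and
  deleting an entry of \<open>js\<close> matches \<open>face_vertex\<close>.\<close>

definition vertex :: "int list \<Rightarrow> nat list \<Rightarrow> nat set \<Rightarrow> int list" where
  "vertex v js U = map (\<lambda>i. if i \<in> (!) js ` U then v ! i + 1 else v ! i) [0..<length v]"

lemma length_vertex [simp]: "length (vertex v js U) = length v"
  by (simp add: vertex_def)

lemma nth_vertex:
  assumes "frame v js" "U \<subseteq> {..<length js}" "r < length js"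
  shows "vertex v js U ! (js ! r) = v ! (js ! r) + of_bool (r \<in> U)"
proof -
  have "js ! r < length v" using frame_nth_less[OF assms(1,3)] .
  moreover have "js ! r \<in> (!) js ` U \<longleftrightarrow> r \<in> U"
    using assms frame_distinct[OF assms(1)] by (auto simp: nth_eq_iff_index_eq subset_iff)
  ultimately show ?thesis by (simp add: vertex_def)
qed

lemma nth_vertex_outside:
  assumes "U \<subseteq> {..<length js}" "i < length v" "i \<notin> set js"
  shows "vertex v js U ! i = v ! i"
  using assms by (auto simp: vertex_def)

lemma vertex_empty [simp]: "vertex v js {} = v"
  by (simp add: vertex_def map_nth)

lemma vertex_singleton: "vertex v js {c} = v[js ! c := v ! (js ! c) + 1]"
  by (rule nth_equalityI) (auto simp: vertex_def nth_list_update)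

lemma vertex_eqI:
  assumes "frame v js" "U \<subseteq> {..<length js}" "length x = length v"
    and "\<And>i. i < length v \<Longrightarrow> i \<notin> set js \<Longrightarrow> x ! i = v ! i"
    and "\<And>r. r < length js \<Longrightarrow> x ! (js ! r) = v ! (js ! r) + of_bool (r \<in> U)"
  shows "x = vertex v js U"
proof (rule nth_equalityI)
  fix i assume "i < length x"
  then have i: "i < length v" using assms(3) by simp
  show "x ! i = vertex v js U ! i"
  proof (cases "i \<in> set js")
    case True
    then obtain r where "r < length js" "i = js ! r" by (auto simp: in_set_conv_nth)
    then show ?thesis using assms nth_vertex by simp
  next
    case False
    then show ?thesis using assms i nth_vertex_outside by simp
  qed
qed (use assms in simp)

lemma mem_cube_eq_vertex:
  assumes "frame v js" "x \<in> cube v js"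
  shows "x = vertex v js {r. r < length js \<and> v ! (js ! r) < x ! (js ! r)}"
proof (rule vertex_eqI)
  fix r assume r: "r < length js"
  then have "js ! r < length v" by (rule frame_nth_less[OF assms(1)])
  then show "x ! (js ! r) = v ! (js ! r) + of_bool (r \<in> {r. r < length js \<and> v ! (js ! r) < x ! (js ! r)})"
    using assms(2) r by (auto simp: mem_cube_iff)
qed (use assms in \<open>auto simp: mem_cube_iff\<close>)

lemma vertex_image:
  assumes "frame v js"
  shows "vertex v js ` Pow {..<length js} = cube v js"
proof
  show "cube v js \<subseteq> vertex v js ` Pow {..<length js}"
  proof
    fix x assume "x \<in> cube v js"
    then show "x \<in> vertex v js ` Pow {..<length js}"
      using mem_cube_eq_vertex[OF assms] by (intro image_eqI) auto
  qed
  show "vertex v js ` Pow {..<length js} \<subseteq> cube v js"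
  proof
    fix x assume "x \<in> vertex v js ` Pow {..<length js}"
    then obtain U where U: "U \<subseteq> {..<length js}" "x = vertex v js U" by auto
    then have "(!) js ` U \<subseteq> set js" by auto
    moreover have "x ! i = (if i \<in> (!) js ` U then v ! i + 1 else v ! i)" if "i < length v" for i
      using that U(2) by (simp add: vertex_def)
    ultimately show "x \<in> cube v js" using U(2) by (auto simp: mem_cube_iff)
  qed
qed

lemma vertex_inj:
  assumes "frame v js" "U \<subseteq> {..<length js}" "U' \<subseteq> {..<length js}" "vertex v js U = vertex v js U'"
  shows "U = U'"
proof -
  have "r \<in> U \<longleftrightarrow> r \<in> U'" if "r < length js" for r
    using nth_vertex[OF assms(1,2) that] nth_vertex[OF assms(1,3) that] assms(4)
    by (auto simp: of_bool_def split: if_splits)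
  then show ?thesis using assms(2,3) by blast
qed

lemma image_nth_insert_index:
  assumes "i < length js" "P \<subseteq> {..<length js - 1}"
  shows "(!) js ` insert_index i ` P = (!) (del i js) ` P"
  using assms by (auto simp: image_image nth_del intro!: image_cong)

lemma vertex_face_vertex_False:
  assumes "i < length js" "P \<subseteq> {..<length js - 1}"
  shows "vertex v js (face_vertex i False P) = vertex v (del i js) P"
  using image_nth_insert_index[OF assms] by (simp add: vertex_def face_vertex_def)

lemma vertex_face_vertex_True:
  assumes "frame v js" "i < length js" "P \<subseteq> {..<length js - 1}"
  shows "vertex v js (face_vertex i True P) = vertex (v[js ! i := v ! (js ! i) + 1]) (del i js) P"
proof -
  have "(!) (del i js) ` P \<subseteq> set (del i js)"
    using assms length_del[OF assms(2)] by auto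
  then have "js ! i \<notin> (!) (del i js) ` P"
    using set_del[OF frame_distinct[OF assms(1)] assms(2)] by auto
  then show ?thesis
    using image_nth_insert_index[OF assms(2,3)]
    by (auto simp: vertex_def face_vertex_def image_Un nth_list_update intro!: nth_equalityI)
qed

section \<open>Singular cubes: maps of the standard cube that respect adjacency\<close>

definition singular_cube :: "nat \<Rightarrow> nat \<Rightarrow> (nat set \<Rightarrow> int list) \<Rightarrow> bool" where
  "singular_cube n q s \<longleftrightarrow> (\<forall>P\<subseteq>{..<q}. length (s P) = n) \<and>
     (\<forall>P\<subseteq>{..<q}. \<forall>j<q. j \<notin> P \<longrightarrow> s (insert j P) = s P \<or> c1_adj (s P) (s (insert j P)))"

lemma c1_adj_distance:
  assumes "c1_adj x y" "length x = n"
  shows "(\<Sum>i<n. \<bar>y ! i - x ! i\<bar>) = 1"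
proof -
  obtain i where i: "i < n" "\<bar>x ! i - y ! i\<bar> = 1" "\<forall>j<n. j \<noteq> i \<longrightarrow> x ! j = y ! j"
    using assms by (auto simp: c1_adj_def)
  have "(\<Sum>j<n. \<bar>y ! j - x ! j\<bar>) = \<bar>y ! i - x ! i\<bar> + (\<Sum>j\<in>{..<n} - {i}. \<bar>y ! j - x ! j\<bar>)"
    using i(1) by (intro sum.remove) auto
  also have "(\<Sum>j\<in>{..<n} - {i}. \<bar>y ! j - x ! j\<bar>) = 0"
    using i(3) by (intro sum.neutral) auto
  finally show ?thesis using i(2) by (simp add: abs_minus_commute)
qed

lemma singular_cube_lipschitz:
  assumes "singular_cube n q s"
  shows "cube_lipschitz n q (\<lambda>P i. s P ! i)"
proof -
  have "(\<Sum>i<n. \<bar>s (D \<union> P) ! i - s P ! i\<bar>) \<le> int (card D)"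
    if "finite D" "D \<inter> P = {}" "D \<union> P \<subseteq> {..<q}" for D P
    using that
  proof (induction D)
    case (insert j D)
    let ?P = "D \<union> P"
    have "(\<Sum>i<n. \<bar>s (insert j ?P) ! i - s P ! i\<bar>) \<le>
        (\<Sum>i<n. \<bar>s (insert j ?P) ! i - s ?P ! i\<bar> + \<bar>s ?P ! i - s P ! i\<bar>)"
      by (rule sum_mono) linarith
    moreover have "(\<Sum>i<n. \<bar>s ?P ! i - s P ! i\<bar>) \<le> int (card D)"
      using insert by auto
    moreover have "(\<Sum>i<n. \<bar>s (insert j ?P) ! i - s ?P ! i\<bar>) \<le> 1"
    proof -
      have "?P \<subseteq> {..<q}" "j < q" "j \<notin> ?P" using insert by auto
      then have "s (insert j ?P) = s ?P \<or> c1_adj (s ?P) (s (insert j ?P))" "length (s ?P) = n"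
        using assms by (auto simp: singular_cube_def)
      then show ?thesis using c1_adj_distance[of "s ?P" "s (insert j ?P)" n] by auto
    qed
    ultimately show ?case using insert by (simp add: sum.distrib)
  qed simp
  note * = this
  show ?thesis
    unfolding cube_lipschitz_def
  proof (intro allI impI)
    fix P P' :: "nat set" assume P: "P \<subseteq> P'" "P' \<subseteq> {..<q}"
    have "finite (P' - P)" using P finite_subset by blast
    moreover have "P' - P \<union> P = P'" using P by auto
    ultimately show "(\<Sum>r<n. \<bar>s P' ! r - s P ! r\<bar>) \<le> int (card (P' - P))"
      using *[of "P' - P" P] P by auto
  qed
qed

lemma singular_cube_face:
  assumes "singular_cube n (Suc q) s" "i \<le> q"
  shows "singular_cube n q (\<lambda>P. s (face_vertex i e P))"
  unfolding singular_cube_def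
proof (intro conjI allI impI)
  fix P assume P: "P \<subseteq> {..<q}"
  then have F: "face_vertex i e P \<subseteq> {..<Suc q}" using assms(2) by (intro face_vertex_subset)
  then show "length (s (face_vertex i e P)) = n" using assms(1) by (simp add: singular_cube_def)
  fix j assume j: "j < q" "j \<notin> P"
  have "face_vertex i e (insert j P) = insert (insert_index i j) (face_vertex i e P)"
    by (auto simp: face_vertex_def)
  moreover have "insert_index i j \<notin> face_vertex i e P"
    using j by (auto simp: face_vertex_def inj_eq[OF inj_insert_index])
  moreover have "insert_index i j < Suc q" using j by (simp add: insert_index_def)
  ultimately show "s (face_vertex i e (insert j P)) = s (face_vertex i e P) \<or>
      c1_adj (s (face_vertex i e P)) (s (face_vertex i e (insert j P)))"
    using assms(1) F by (simp add: singular_cube_def)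
qed

text \<open>Truncated coordinates: they do not change along an edge unless the edge joins \<open>w ! (ks ! r)\<close> to
  \<open>w ! (ks ! r) + 1\<close>, so the cup product ignores translates of \<open>cube w ks\<close> along itself.\<close>

definition threshold :: "int list \<Rightarrow> nat list \<Rightarrow> (nat set \<Rightarrow> int list) \<Rightarrow> nat set \<Rightarrow> nat \<Rightarrow> int" where
  "threshold w ks s P r = of_bool (w ! (ks ! r) < s P ! (ks ! r))"

lemma sum_nth_frame_le:
  fixes F :: "nat \<Rightarrow> int"
  assumes "frame w ks" "\<And>i. F i \<ge> 0"
  shows "(\<Sum>r<length ks. F (ks ! r)) \<le> (\<Sum>i<length w. F i)"
proof -
  have "(\<Sum>r<length ks. F (ks ! r)) = (\<Sum>i\<in>set ks. F i)"
    by (rule sum.reindex_bij_betw) (rule bij_betw_nth[OF frame_distinct[OF assms(1)] refl refl])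
  also have "\<dots> \<le> (\<Sum>i<length w. F i)"
    using assms by (intro sum_mono2) (auto simp: frame_def)
  finally show ?thesis .
qed

lemma threshold_lipschitz:
  assumes "singular_cube (length w) q s" "frame w ks"
  shows "cube_lipschitz (length ks) q (threshold w ks s)"
  unfolding cube_lipschitz_def
proof (intro allI impI)
  fix P P' :: "nat set" assume P: "P \<subseteq> P'" "P' \<subseteq> {..<q}"
  have "(\<Sum>r<length ks. \<bar>threshold w ks s P' r - threshold w ks s P r\<bar>) \<le>
      (\<Sum>r<length ks. \<bar>s P' ! (ks ! r) - s P ! (ks ! r)\<bar>)"
    by (rule sum_mono) (auto simp: threshold_def)
  also have "\<dots> \<le> (\<Sum>i<length w. \<bar>s P' ! i - s P ! i\<bar>)"
    by (rule sum_nth_frame_le[OF assms(2)]) simp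
  also have "\<dots> \<le> int (card (P' - P))"
    using cube_lipschitzD[OF singular_cube_lipschitz[OF assms(1)] P] .
  finally show "(\<Sum>r<length ks. \<bar>threshold w ks s P' r - threshold w ks s P r\<bar>) \<le> int (card (P' - P))" .
qed

text \<open>The automorphisms of the hypercube: \<open>a\<close> permutes the directions, and the
  symmetric difference with \<open>B\<close>, the image of the bottom vertex, reflects some of
  them.\<close>

definition signed_isometry ::
    "nat \<Rightarrow> (nat set \<Rightarrow> int list) \<Rightarrow> int list \<Rightarrow> nat list \<Rightarrow> nat set \<Rightarrow> (nat \<Rightarrow> nat) \<Rightarrow> bool" where
  "signed_isometry q s w ks B a \<longleftrightarrow> B \<subseteq> {..<q} \<and> bij_betw a {..<q} {..<q} \<and>
     (\<forall>P\<subseteq>{..<q}. s P = vertex w ks (sym_diff B (a ` P)))"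

lemma signed_isometry_image:
  assumes "signed_isometry q s w ks B a" "frame w ks" "length ks = q"
  shows "s ` Pow {..<q} = cube w ks"
proof -
  have B: "B \<subseteq> {..<q}" and a: "bij_betw a {..<q} {..<q}"
    and s: "\<And>P. P \<subseteq> {..<q} \<Longrightarrow> s P = vertex w ks (sym_diff B (a ` P))"
    using assms(1) by (auto simp: signed_isometry_def)
  have img: "a ` P \<subseteq> {..<q}" if "P \<subseteq> {..<q}" for P
    using a that by (auto simp: bij_betw_def)
  have "(\<lambda>P. sym_diff B (a ` P)) ` Pow {..<q} = Pow {..<q}"
  proof
    show "(\<lambda>P. sym_diff B (a ` P)) ` Pow {..<q} \<subseteq> Pow {..<q}" using B img by blast
    show "Pow {..<q} \<subseteq> (\<lambda>P. sym_diff B (a ` P)) ` Pow {..<q}"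
    proof
      fix U assume U: "U \<in> Pow {..<q}"
      have "a ` {..<q} = {..<q}" using a by (simp add: bij_betw_def)
      moreover have "sym_diff B U \<subseteq> {..<q}" using U B by auto
      ultimately obtain P where P: "P \<subseteq> {..<q}" "sym_diff B U = a ` P"
        by (metis subset_imageE)
      then have "U = sym_diff B (a ` P)" by blast
      then show "U \<in> (\<lambda>P. sym_diff B (a ` P)) ` Pow {..<q}" using P by blast
    qed
  qed
  moreover have "s ` Pow {..<q} = vertex w ks ` (\<lambda>P. sym_diff B (a ` P)) ` Pow {..<q}"
    using s by (simp add: image_image)
  ultimately show ?thesis using vertex_image[OF assms(2)] assms(3) by simp
qed

text \<open>A nonzero cup product makes the truncated coordinates antipodal, so every direction in
  \<open>ks\<close> needs a change. The cube has length for \<open>q\<close> unit changes in total;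
  hence all other coordinates are constant, and those in \<open>ks\<close> stay within the two
  values at the threshold.\<close>

lemma threshold_cup_form_nonzero:
  assumes s: "singular_cube (length w) q s" and w: "frame w ks" "length ks = q"
    and nz: "cup_form q (threshold w ks s) \<noteq> 0"
  obtains w' B a where "length w' = length w" "\<And>i. i \<in> set ks \<Longrightarrow> w' ! i = w ! i"
    "signed_isometry q s w' ks B a"
proof -
  let ?h = "threshold w ks s" and ?T = "{..<q}"
  have L: "cube_lipschitz q q ?h" using threshold_lipschitz[OF s w(1)] w(2) by simp
  have A: "antipodal q ?h" using cup_form_nonzero_antipodal[OF L nz] .
  obtain a where a: "a \<in> ?T \<rightarrow> ?T" "\<And>c. c < q \<Longrightarrow> moved q ?h {c} = {a c}"
    using moved_singleton[OF L A] by blast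
  have inj: "inj_on a ?T"
    using antipodal_det_nonzero_inj[OF L A _ a(2)] nz cup_form_eq_det[OF L A] by simp
  have "a ` ?T = ?T" using inj a(1) by (intro card_subset_eq) (auto simp: card_image)
  then have bij: "bij_betw a ?T ?T" using inj by (simp add: bij_betw_def)
  \<comment> \<open>The orthogonal translate: only the coordinates outside \<open>ks\<close>, which
    will turn out to be constant, are taken from \<open>s\<close>.\<close>
  define w' where "w' = map (\<lambda>i. if i \<in> set ks then w ! i else s {} ! i) [0..<length w]"
  define B where "B = {r. r < q \<and> w ! (ks ! r) < s {} ! (ks ! r)}"
  have len: "length (s P) = length w" if "P \<subseteq> ?T" for P
    using s that by (simp add: singular_cube_def)
  have w': "length w' = length w" "\<And>i. i \<in> set ks \<Longrightarrow> w' ! i = w ! i"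
    using w(1) by (auto simp: w'_def frame_def)
  have fw': "frame w' ks" using w(1) w'(1) by (simp add: frame_def)
  have *: "s P = vertex w' ks (sym_diff B (a ` P))" if P: "P \<subseteq> ?T" for P
  proof -
    have finP: "finite P" using P finite_subset by blast
    \<comment> \<open>The distance that coordinate \<open>i\<close> travels on the way from the
      bottom over \<open>P\<close> to the top. The total is at most \<open>q\<close>, and each of
      the \<open>q\<close> directions in \<open>ks\<close> needs at least 1.\<close>
    define t where "t i = \<bar>s P ! i - s {} ! i\<bar> + \<bar>s ?T ! i - s P ! i\<bar>" for i
    have "(\<Sum>i<length w. \<bar>s P ! i - s {} ! i\<bar>) \<le> int (card P)"
      using cube_lipschitzD[OF singular_cube_lipschitz[OF s], of "{}" P] P by simp
    moreover have "(\<Sum>i<length w. \<bar>s ?T ! i - s P ! i\<bar>) \<le> int q - int (card P)"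
      using cube_lipschitzD[OF singular_cube_lipschitz[OF s] P] card_Diff_subset[OF finP P]
        card_mono[OF _ P] by simp
    ultimately have "(\<Sum>i<length w. t i) \<le> int q"
      by (simp add: t_def sum.distrib)
    then have "(\<Sum>i<length w. t i - (if i \<in> set ks then 1 else 0)) \<le> 0"
      using w by (simp add: sum_subtractf frame_def sum.If_cases Int_absorb1
          distinct_card[OF frame_distinct[OF w(1)]])
    moreover have flip: "?h ?T r \<noteq> ?h {} r" if "r < q" for r
      using A that by (auto simp: antipodal_def)
    have nonneg: "0 \<le> t i - (if i \<in> set ks then 1 else 0)" if "i < length w" for i
    proof (cases "i \<in> set ks")
      case True
      then obtain r where "r < q" "i = ks ! r" using w by (auto simp: in_set_conv_nth)
      then have "s ?T ! i \<noteq> s {} ! i" using flip[of r] by (auto simp: threshold_def)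
      then have "t i \<ge> 1" unfolding t_def by linarith
      then show ?thesis using True by simp
    qed (simp add: t_def)
    have "(\<Sum>i<length w. t i - (if i \<in> set ks then 1 else 0)) \<ge> 0"
      by (rule sum_nonneg) (use nonneg in auto)
    ultimately have "(\<Sum>i<length w. t i - (if i \<in> set ks then 1 else 0)) = 0" by linarith
    moreover have "(\<Sum>i<length w. t i - (if i \<in> set ks then 1 else 0)) = 0 \<longleftrightarrow>
        (\<forall>i\<in>{..<length w}. t i - (if i \<in> set ks then 1 else 0) = 0)"
      by (rule sum_nonneg_eq_0_iff) (use nonneg in auto)
    ultimately have t: "t i = (if i \<in> set ks then 1 else 0)" if "i < length w" for i
      using that by auto
    have sub: "sym_diff B (a ` P) \<subseteq> {..<length ks}"
      using a(1) P w(2) by (auto simp: B_def)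
    show ?thesis
    proof (rule vertex_eqI[OF fw' sub])
      show "length (s P) = length w'" using len[OF P] w' by simp
      fix i assume "i < length w'" "i \<notin> set ks"
      then show "s P ! i = w' ! i" using t[of i] by (simp add: w'_def t_def)
    next
      fix r assume "r < length ks"
      then have r: "r < q" "ks ! r < length w" "ks ! r \<in> set ks"
        using w frame_nth_less[OF w(1)] by auto
      have "moved q ?h P = a ` P"
        by (rule moved_eq_image[OF L A P a(2)]) (use inj P in \<open>auto intro: inj_on_subset\<close>)
      then have "r \<in> a ` P \<longleftrightarrow> ?h P r \<noteq> ?h {} r" using r by (auto simp: moved_def)
      moreover have "t (ks ! r) = 1" using t r by simp
      ultimately show "s P ! (ks ! r) = w' ! (ks ! r) + of_bool (r \<in> sym_diff B (a ` P))"
        using flip[of r] r w'(2)[OF r(3)]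
        by (auto simp: threshold_def B_def t_def split: if_splits)
    qed
  qed
  have "B \<subseteq> ?T" by (auto simp: B_def)
  then have "signed_isometry q s w' ks B a"
    unfolding signed_isometry_def using bij * by blast
  with w' show ?thesis using that by blast
qed

text \<open>The \<open>q\<close> neighbours of a vertex are mapped injectively to the
  \<open>q\<close> neighbours of its image, hence onto them, so every path starting at
  \<open>T {}\<close> lifts. A shortest path to \<open>T {..<q}\<close> lifts to a path from
  \<open>{}\<close> to \<open>{..<q}\<close> and therefore has at least \<open>q\<close>
  edges.\<close>

lemma bijective_cube_map_antipode:
  fixes T :: "nat set \<Rightarrow> nat set"
  assumes T: "\<And>P. P \<subseteq> {..<q} \<Longrightarrow> T P \<subseteq> {..<q}" and inj: "inj_on T (Pow {..<q})"
    and edge: "\<And>P j. P \<subseteq> {..<q} \<Longrightarrow> j < q \<Longrightarrow> j \<notin> P \<Longrightarrow> \<exists>r<q. T (insert j P) = sym_diff (T P) {r}"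
  shows "T {..<q} = {..<q} - T {}"
proof -
  have edge': "\<exists>r<q. T (sym_diff P {j}) = sym_diff (T P) {r}" if P: "P \<subseteq> {..<q}" "j < q" for P j
  proof (cases "j \<in> P")
    case True
    obtain r where r: "r < q" "T (insert j (P - {j})) = sym_diff (T (P - {j})) {r}"
      using edge[of "P - {j}" j] P by blast
    then have "T (P - {j}) = sym_diff (T P) {r}" using True by (auto simp: insert_absorb)
    moreover have "sym_diff P {j} = P - {j}" using True by auto
    ultimately show ?thesis using r(1) by auto
  next
    case False
    then have "sym_diff P {j} = insert j P" by auto
    then show ?thesis using edge[OF P False] by auto
  qed
  have step: "\<exists>P'\<subseteq>{..<q}. T P' = sym_diff (T P) {r} \<and> card P' \<le> Suc (card P)"
    if P: "P \<subseteq> {..<q}" and r: "r < q" for P r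
  proof -
    obtain b where b: "\<And>j. j < q \<Longrightarrow> b j < q \<and> T (sym_diff P {j}) = sym_diff (T P) {b j}"
      using edge'[OF P] by metis
    have "inj_on b {..<q}"
    proof
      fix j j' assume j: "j \<in> {..<q}" "j' \<in> {..<q}" "b j = b j'"
      then have "T (sym_diff P {j}) = T (sym_diff P {j'})" using b by auto
      then have "sym_diff P {j} = sym_diff P {j'}"
        by (rule inj_onD[OF inj]) (use P j in auto)
      then show "j = j'" by blast
    qed
    then have "b ` {..<q} = {..<q}" using b by (intro card_subset_eq) (auto simp: card_image)
    then obtain j where j: "j < q" "r = b j" using r by (metis imageE lessThan_iff)
    have "card (sym_diff P {j}) \<le> card (insert j P)"
      using P by (intro card_mono) (auto intro: finite_subset)
    also have "\<dots> \<le> Suc (card P)" by (rule card_insert_le_m1) simp_all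
    finally show ?thesis using b[OF j(1)] j P by (intro exI[of _ "sym_diff P {j}"]) auto
  qed
  have reach: "\<exists>P\<subseteq>{..<q}. T P = sym_diff (T {}) U \<and> card P \<le> card U" if "finite U" "U \<subseteq> {..<q}" for U
    using that
  proof (induction U)
    case empty
    then show ?case by (intro exI[of _ "{}"]) auto
  next
    case (insert r U)
    then obtain P where P: "P \<subseteq> {..<q}" "T P = sym_diff (T {}) U" "card P \<le> card U" by auto
    obtain P' where P': "P' \<subseteq> {..<q}" "T P' = sym_diff (T P) {r}" "card P' \<le> Suc (card P)"
      using step[OF P(1), of r] insert by auto
    have "T P' = sym_diff (T {}) (insert r U)" using P'(2) P(2) insert(2) by auto
    then show ?case using P' P insert by (intro exI[of _ P']) auto
  qed
  let ?U = "sym_diff (T {}) (T {..<q})"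
  have U: "?U \<subseteq> {..<q}" using T[of "{}"] T[of "{..<q}"] by auto
  then obtain P where P: "P \<subseteq> {..<q}" "T P = sym_diff (T {}) ?U" "card P \<le> card ?U"
    using reach[of ?U] finite_subset by blast
  have "T P = T {..<q}" using P(2) by blast
  then have "P = {..<q}" by (rule inj_onD[OF inj]) (use P in auto)
  then have "?U = {..<q}"
    using P(3) U card_mono[OF _ U] by (intro card_subset_eq) auto
  then show ?thesis using T[of "{..<q}"] T[of "{}"] by blast
qed

text \<open>A surjection between sets of \<open>2^q\<close> vertices is injective, so no edge
  collapses and opposite extreme vertices have opposite images. Then the truncated coordinates are
  antipodal and the rigidity results apply.\<close>

lemma singular_cube_onto:
  assumes s: "singular_cube (length w) q s" and w: "frame w ks" "length ks = q"
    and onto: "s ` Pow {..<q} = cube w ks"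
  shows "\<exists>B a. signed_isometry q s w ks B a"
    and "cup_form q (threshold w ks s) = det (edge_matrix q (\<lambda>P r. s P ! (ks ! r)))"
proof -
  let ?h = "threshold w ks s"
  define T where "T P = {r. r < q \<and> w ! (ks ! r) < s P ! (ks ! r)}" for P
  have sT: "s P = vertex w ks (T P)" if "P \<subseteq> {..<q}" for P
  proof -
    have "s P \<in> cube w ks" using onto that by blast
    then show ?thesis using mem_cube_eq_vertex[OF w(1)] w(2) unfolding T_def by metis
  qed
  have T: "T P \<subseteq> {..<q}" for P by (auto simp: T_def)
  have h: "?h P r = of_bool (r \<in> T P)" if "r < q" for P r
    using that by (simp add: threshold_def T_def)
  have "T ` Pow {..<q} = Pow {..<q}"
  proof
    show "T ` Pow {..<q} \<subseteq> Pow {..<q}" using T by blast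
    show "Pow {..<q} \<subseteq> T ` Pow {..<q}"
    proof
      fix U assume U: "U \<in> Pow {..<q}"
      then have "vertex w ks U \<in> s ` Pow {..<q}" using onto vertex_image[OF w(1)] w(2) by blast
      then obtain P where P: "P \<subseteq> {..<q}" "vertex w ks U = s P" by blast
      then have "U = T P" using vertex_inj[OF w(1)] sT[OF P(1)] T U w(2) by auto
      then show "U \<in> T ` Pow {..<q}" using P by blast
    qed
  qed
  then have inj: "inj_on T (Pow {..<q})" by (intro eq_card_imp_inj_on) auto
  have L: "cube_lipschitz q q ?h" using threshold_lipschitz[OF s w(1)] w(2) by simp
  have edge: "\<exists>r<q. T (insert j P) = sym_diff (T P) {r}" if P: "P \<subseteq> {..<q}" "j < q" "j \<notin> P" for P j
  proof -
    define D where "D = sym_diff (T P) (T (insert j P))"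
    have D: "D \<subseteq> {..<q}" unfolding D_def using T by blast
    have "int (card D) = (\<Sum>r<q. if r \<in> D then 1 else 0)"
      using D by (simp add: sum.If_cases Int_absorb1)
    also have "\<dots> = (\<Sum>r<q. \<bar>?h (insert j P) r - ?h P r\<bar>)"
      by (intro sum.cong) (auto simp: h D_def)
    also have "\<dots> \<le> int (card (insert j P - P))"
      by (rule cube_lipschitzD[OF L]) (use P in auto)
    also have "insert j P - P = {j}" using P by auto
    finally have "card D \<le> 1" by simp
    moreover have "T (insert j P) \<noteq> T P"
    proof
      assume "T (insert j P) = T P"
      then have "insert j P = P" by (rule inj_onD[OF inj]) (use P in auto)
      then show False using P by blast
    qed
    then have "D \<noteq> {}" unfolding D_def by blast
    then have "card D \<noteq> 0" using D by (simp add: finite_subset)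
    ultimately have "card D = 1" by linarith
    then obtain r where r: "D = {r}" by (auto simp: card_1_singleton_iff)
    then have "T (insert j P) = sym_diff (T P) {r}" unfolding D_def by blast
    moreover have "r < q" using r D by auto
    ultimately show ?thesis by blast
  qed
  have anti: "T {..<q} = {..<q} - T {}"
    using bijective_cube_map_antipode[OF _ inj edge] T by blast
  have A: "antipodal q ?h"
    unfolding antipodal_def by (auto simp: h anti)
  \<comment> \<open>On the image cube, truncation merely subtracts the constant
    \<open>w ! (ks ! r)\<close>.\<close>
  have "edge_matrix q ?h = edge_matrix q (\<lambda>P r. s P ! (ks ! r))"
  proof (rule eq_matI)
    fix r c assume "r < dim_row (edge_matrix q (\<lambda>P r. s P ! (ks ! r)))"
      "c < dim_col (edge_matrix q (\<lambda>P r. s P ! (ks ! r)))"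
    then have rc: "r < q" "c < q" by (auto simp: edge_matrix_def)
    have "s P ! (ks ! r) = w ! (ks ! r) + ?h P r" if "P \<subseteq> {..<q}" for P
      using sT[OF that] nth_vertex[OF w(1), of "T P" r] T w(2) rc h by simp
    then show "edge_matrix q ?h $$ (r, c) = edge_matrix q (\<lambda>P r. s P ! (ks ! r)) $$ (r, c)"
      using rc by (simp add: edge_matrix_def)
  qed (simp_all add: edge_matrix_def)
  then show "cup_form q ?h = det (edge_matrix q (\<lambda>P r. s P ! (ks ! r)))"
    using cup_form_eq_det[OF L A] by simp
  obtain a where a: "a \<in> {..<q} \<rightarrow> {..<q}" "\<And>c. c < q \<Longrightarrow> moved q ?h {c} = {a c}"
    using moved_singleton[OF L A] by blast
  have moved: "moved q ?h P = sym_diff (T {}) (T P)" for P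
    using T by (auto simp: moved_def h T_def)
  have inja: "inj_on a {..<q}"
  proof
    fix c c' assume c: "c \<in> {..<q}" "c' \<in> {..<q}" "a c = a c'"
    then have "sym_diff (T {}) (T {c}) = sym_diff (T {}) (T {c'})"
      using a(2)[of c] a(2)[of c'] unfolding moved by simp
    then have "T {c} = T {c'}" by blast
    then have "{c} = {c'}" by (rule inj_onD[OF inj]) (use c in auto)
    then show "c = c'" by simp
  qed
  have "a ` {..<q} = {..<q}" using inja a(1) by (intro card_subset_eq) (auto simp: card_image)
  then have "bij_betw a {..<q} {..<q}" using inja by (simp add: bij_betw_def)
  moreover have "s P = vertex w ks (sym_diff (T {}) (a ` P))" if P: "P \<subseteq> {..<q}" for P
  proof -
    have "moved q ?h P = a ` P"
      by (rule moved_eq_image[OF L A P a(2)]) (use inja P in \<open>auto intro: inj_on_subset\<close>)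
    then have "T P = sym_diff (T {}) (a ` P)" unfolding moved by blast
    then show ?thesis using sT[OF P] by simp
  qed
  ultimately have "signed_isometry q s w ks (T {}) a"
    using T by (simp add: signed_isometry_def)
  then show "\<exists>B a. signed_isometry q s w ks B a" by blast
qed

section \<open>The boundary of the image of a cube\<close>

definition singular_image :: "nat \<Rightarrow> (nat set \<Rightarrow> int list) \<Rightarrow> int list set" where
  "singular_image q s = s ` Pow {..<q}"

definition coordinates :: "nat list \<Rightarrow> (nat set \<Rightarrow> int list) \<Rightarrow> nat set \<Rightarrow> nat \<Rightarrow> int" where
  "coordinates ks s P r = s P ! (ks ! r)"

text \<open>The signed image of one cube under the induced map, stated for singular cubes so that
  prisms are covered; \<open>cube_map_cube\<close> makes the connection.\<close>

definition image_chain :: "nat \<Rightarrow> (nat set \<Rightarrow> int list) \<Rightarrow> (int list set \<Rightarrow>\<^sub>0 int)" where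
  "image_chain q s =
     (let R = singular_image q s in
      if elementary_cube R \<and> cube_dim R = q
      then frag_cmul (det (edge_matrix q (coordinates (nondeg_dirs R) s))) (frag_of R) else 0)"

lemma singular_image_cong:
  "(\<And>P. P \<subseteq> {..<q} \<Longrightarrow> s P = s' P) \<Longrightarrow> singular_image q s = singular_image q s'"
  by (auto simp: singular_image_def)

lemma image_chain_cong:
  assumes "\<And>P. P \<subseteq> {..<q} \<Longrightarrow> s P = s' P"
  shows "image_chain q s = image_chain q s'"
proof -
  have "edge_matrix q (coordinates ks s) = edge_matrix q (coordinates ks s')" for ks
    using assms by (auto simp: edge_matrix_def coordinates_def intro!: cong_mat)
  moreover have "singular_image q s = singular_image q s'"
    by (rule singular_image_cong) (rule assms)
  ultimately show ?thesis
    unfolding image_chain_def Let_def by simp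
qed

lemma image_chain_onto:
  assumes "frame w ks" "length ks = q" "singular_image q s = cube w ks"
  shows "image_chain q s = frag_cmul (det (edge_matrix q (coordinates ks s))) (frag_of (cube w ks))"
  using assms by (simp add: image_chain_def elementary_cube_cube cube_dim_cube nondeg_dirs_cube)

lemma lookup_image_chain:
  "poly_mapping.lookup (image_chain q s) R =
     (if singular_image q s = R \<and> elementary_cube R \<and> cube_dim R = q
      then det (edge_matrix q (coordinates (nondeg_dirs R) s)) else 0)"
  by (auto simp: image_chain_def Let_def)

lemma map_Min_factors_cube: "map Min (factors (cube v js)) = v"
  by (rule nth_equalityI) (auto simp: nth_factors_cube)

lemma cube_map_cube:
  assumes "frame v js"
  shows "cube_map f (frag_of (cube v js)) = image_chain (length js) (f \<circ> vertex v js)"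
proof -
  let ?R = "f ` cube v js"
  have R: "singular_image (length js) (f \<circ> vertex v js) = ?R"
    unfolding singular_image_def vertex_image[OF assms, symmetric] by (simp add: image_comp)
  have "linear_part f (cube v js) =
      edge_matrix (length js) (coordinates (nondeg_dirs ?R) (f \<circ> vertex v js))"
    if "cube_dim ?R = length js"
    using that
    by (auto simp: linear_part_def Let_def map_Min_factors_cube nondeg_dirs_cube[OF assms] edge_matrix_def
        coordinates_def cube_dim_def vertex_singleton intro!: eq_matI)
  then show ?thesis
    unfolding image_chain_def R Let_def
    by (simp add: cube_map_def cube_sign_def embedding_on_def cube_dim_cube[OF assms])
qed

section \<open>Boundary of the image of an embedded cube\<close>

lemma cube_boundary_cube:
  assumes "frame v js"
  shows "cube_boundary (frag_of (cube v js)) =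
    (\<Sum>i<length js. frag_cmul ((-1) ^ Suc i)
       (frag_of (cube v (del i js)) - frag_of (cube (v[js ! i := v ! (js ! i) + 1]) (del i js))))"
  by (simp add: cube_boundary_def cube_dim_cube[OF assms] nondeg_dirs_cube[OF assms]
      sum.atLeast1_atMost_eq lower_face_cube[OF assms] upper_face_cube[OF assms])

lemma cube_boundary_cmul: "cube_boundary (frag_cmul c x) = frag_cmul c (cube_boundary x)"
  by (simp add: cube_boundary_def frag_extend_cmul)

text \<open>Passing to the opposite face changes coordinate \<open>a i\<close> only, whose row is
  deleted; hence the same minor serves both values of \<open>e\<close>.\<close>

lemma face_matrix:
  assumes "signed_isometry (Suc q) s w ks B a" "frame w ks" "length ks = Suc q" "i \<le> q"
  shows "edge_matrix q (coordinates (del (a i) ks) (\<lambda>P. s (face_vertex i e P))) =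
      mat_delete (edge_matrix (Suc q) (coordinates ks s)) (a i) i"
proof -
  have B: "B \<subseteq> {..<Suc q}" and bij: "bij_betw a {..<Suc q} {..<Suc q}"
    and s: "\<And>P. P \<subseteq> {..<Suc q} \<Longrightarrow> s P = vertex w ks (sym_diff B (a ` P))"
    using assms(1) by (auto simp: signed_isometry_def)
  have a_less: "a c < Suc q" if "c < Suc q" for c using bij that by (auto simp: bij_betw_def)
  have coord: "coordinates ks s P r = w ! (ks ! r) + of_bool (r \<in> sym_diff B (a ` P))"
    if "P \<subseteq> {..<Suc q}" "r < Suc q" for P r
  proof -
    have "sym_diff B (a ` P) \<subseteq> {..<length ks}" using B a_less that assms(3) by auto
    then show ?thesis
      using nth_vertex[OF assms(2), of "sym_diff B (a ` P)" r] that assms(3)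
      by (simp add: coordinates_def s)
  qed
  show ?thesis
  proof (rule eq_matI)
    fix r c assume "r < dim_row (mat_delete (edge_matrix (Suc q) (coordinates ks s)) (a i) i)"
      "c < dim_col (mat_delete (edge_matrix (Suc q) (coordinates ks s)) (a i) i)"
    then have rc: "r < q" "c < q" by (auto simp: edge_matrix_def)
    let ?r = "insert_index (a i) r" and ?c = "insert_index i c"
    have rc': "?r < Suc q" "?c < Suc q" using rc by (auto simp: insert_index_def)
    have del: "coordinates (del (a i) ks) t P r = coordinates ks t P ?r" for t P
      using rc a_less[of i] assms by (simp add: coordinates_def nth_del)
    have ac: "a ?c \<noteq> a i" using bij rc' assms(4) by (auto simp: bij_betw_def inj_on_eq_iff)
    have sub: "face_vertex i e {c} \<subseteq> {..<Suc q}" "face_vertex i e {} \<subseteq> {..<Suc q}"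
      by (rule face_vertex_subset[OF assms(4)], use rc in simp)+
    have "coordinates (del (a i) ks) (\<lambda>P. s (face_vertex i e P)) {c} r -
        coordinates (del (a i) ks) (\<lambda>P. s (face_vertex i e P)) {} r =
        coordinates ks s (face_vertex i e {c}) ?r - coordinates ks s (face_vertex i e {}) ?r"
      unfolding del by (simp add: coordinates_def)
    also have "\<dots> = coordinates ks s {?c} ?r - coordinates ks s {} ?r"
      unfolding coord[OF sub(1) rc'(1)] coord[OF sub(2) rc'(1)]
      using rc' coord[of "{?c}" ?r] coord[of "{}" ?r] ac by (auto simp: face_vertex_def)
    finally show "edge_matrix q (coordinates (del (a i) ks) (\<lambda>P. s (face_vertex i e P))) $$ (r, c) =
        mat_delete (edge_matrix (Suc q) (coordinates ks s)) (a i) i $$ (r, c)"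
      using rc rc' by (simp add: edge_matrix_def mat_delete_def insert_index_def)
  qed (simp_all add: edge_matrix_def)
qed

text \<open>A reflection in direction \<open>a i\<close>, that is \<open>a i \<in> B\<close>,
  exchanges the lower and the upper face of the image.\<close>

lemma face_image:
  assumes "signed_isometry (Suc q) s w ks B a" "frame w ks" "length ks = Suc q" "i \<le> q"
  shows "singular_image q (\<lambda>P. s (face_vertex i e P)) =
    cube (if (a i \<in> B) \<noteq> e then w[ks ! a i := w ! (ks ! a i) + 1] else w) (del (a i) ks)"
    (is "?L = cube ?w ?ks")
proof -
  have B: "B \<subseteq> {..<Suc q}" and bij: "bij_betw a {..<Suc q} {..<Suc q}"
    and s: "\<And>P. P \<subseteq> {..<Suc q} \<Longrightarrow> s P = vertex w ks (sym_diff B (a ` P))"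
    using assms(1) by (auto simp: signed_isometry_def)
  let ?b = "(a i \<in> B) \<noteq> e"
  have ai: "a i < length ks" using bij assms(3,4) by (auto simp: bij_betw_def)
  have a_sub: "a ` P \<subseteq> {..<Suc q}" if "P \<subseteq> {..<Suc q}" for P
    using bij that by (auto simp: bij_betw_def)
  have a_mem: "a i \<in> a ` P \<longleftrightarrow> i \<in> P" if "P \<subseteq> {..<Suc q}" for P
    by (rule inj_on_image_mem_iff[OF bij_betw_imp_inj_on[OF bij]]) (use assms(4) that in auto)
  have i_mem: "i \<in> face_vertex i e P \<longleftrightarrow> e" for e P by (auto simp: face_vertex_def)
  have ai_mem: "a i \<in> face_vertex (a i) b V \<longleftrightarrow> b" for b V by (auto simp: face_vertex_def)
  have face: "vertex w ks (face_vertex (a i) ?b V) = vertex ?w ?ks V" if "V \<subseteq> {..<q}" for V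
    using vertex_face_vertex_False[OF ai, of V w] vertex_face_vertex_True[OF assms(2) ai, of V]
      that assms(3) by (cases ?b) auto
  have fr: "frame ?w ?ks" "length ?ks = q"
    using frame_del[OF assms(2) ai] length_del[OF ai] assms(3) by auto
  have "?L = vertex ?w ?ks ` Pow {..<q}"
  proof (intro equalityI subsetI)
    fix x assume "x \<in> ?L"
    then obtain P where P: "P \<subseteq> {..<q}" "x = s (face_vertex i e P)"
      by (auto simp: singular_image_def)
    let ?F = "face_vertex i e P"
    have F: "?F \<subseteq> {..<Suc q}" using P assms(4) by (intro face_vertex_subset)
    let ?U = "sym_diff B (a ` ?F)"
    have U: "?U \<subseteq> {..<Suc q}" "a i \<le> q" using B a_sub[OF F] ai assms(3) by auto
    obtain V where V: "V \<subseteq> {..<q}" "?U = face_vertex (a i) (a i \<in> ?U) V"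
      by (rule face_vertex_surj[OF U])
    have b: "a i \<in> ?U \<longleftrightarrow> ?b" using a_mem[OF F] i_mem by auto
    have "x = vertex w ks (face_vertex (a i) ?b V)"
      unfolding P(2) s[OF F] by (rule arg_cong[OF V(2)[unfolded b]])
    then show "x \<in> vertex ?w ?ks ` Pow {..<q}" using face[OF V(1)] V(1) by auto
  next
    fix x assume "x \<in> vertex ?w ?ks ` Pow {..<q}"
    then obtain V where V: "V \<subseteq> {..<q}" "x = vertex w ks (face_vertex (a i) ?b V)"
      using face by auto
    let ?W = "face_vertex (a i) ?b V"
    have W: "?W \<subseteq> {..<length ks}" using V ai assms(3) face_vertex_subset[of "a i" q V] by simp
    have "x \<in> s ` Pow {..<Suc q}"
      using signed_isometry_image[OF assms(1-3)] vertex_image[OF assms(2)] V(2) W by blast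
    then obtain P where P: "P \<subseteq> {..<Suc q}" "x = s P" by auto
    have "sym_diff B (a ` P) \<subseteq> {..<length ks}" using B a_sub[OF P(1)] assms(3) by auto
    then have eq: "sym_diff B (a ` P) = ?W"
      using vertex_inj[OF assms(2) _ W] s[OF P(1)] P(2) V(2) by simp
    have "a i \<in> sym_diff B (a ` P) \<longleftrightarrow> ?b" unfolding eq by (rule ai_mem)
    then have ie: "i \<in> P \<longleftrightarrow> e" using a_mem[OF P(1)] by blast
    obtain P' where "P' \<subseteq> {..<q}" "P = face_vertex i (i \<in> P) P'"
      by (rule face_vertex_surj[OF P(1) assms(4)])
    then have "P' \<subseteq> {..<q}" "P = face_vertex i e P'" unfolding ie by simp_all
    then show "x \<in> ?L" using P(2) by (auto simp: singular_image_def)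
  qed
  then show ?thesis using vertex_image[OF fr(1)] fr(2) by simp
qed

text \<open>Row \<open>a i\<close> of the matrix has a single nonzero entry, 1 or -1 in column
  \<open>i\<close>, so Laplace expansion expresses the sign of the cube by that of its faces in
  direction \<open>i\<close>. The two sums then agree term by term after reindexing by
  \<open>a\<close>.\<close>

lemma cube_boundary_image_chain_isometry:
  assumes iso: "signed_isometry (Suc q) s w ks B a" and w: "frame w ks" "length ks = Suc q"
  shows "cube_boundary (image_chain (Suc q) s) =
    (\<Sum>i\<le>q. frag_cmul ((-1) ^ Suc i) (image_chain q (\<lambda>P. s (face_vertex i False P)) -
                                        image_chain q (\<lambda>P. s (face_vertex i True P))))"
proof -
  have B: "B \<subseteq> {..<Suc q}" and bij: "bij_betw a {..<Suc q} {..<Suc q}"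
    and s: "\<And>P. P \<subseteq> {..<Suc q} \<Longrightarrow> s P = vertex w ks (sym_diff B (a ` P))"
    using iso by (auto simp: signed_isometry_def)
  let ?M = "edge_matrix (Suc q) (coordinates ks s)"
  let ?lo = "\<lambda>r. frag_of (cube w (del r ks))"
  let ?up = "\<lambda>r. frag_of (cube (w[ks ! r := w ! (ks ! r) + 1]) (del r ks))"
  have a_less: "a c < Suc q" if "c < Suc q" for c using bij that by (auto simp: bij_betw_def)
  have coord: "coordinates ks s P r = w ! (ks ! r) + of_bool (r \<in> sym_diff B (a ` P))"
    if "P \<subseteq> {..<Suc q}" "r < Suc q" for P r
  proof -
    have "sym_diff B (a ` P) \<subseteq> {..<length ks}" using B a_less that w(2) by auto
    then show ?thesis
      using nth_vertex[OF w(1), of "sym_diff B (a ` P)" r] that w(2)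
      by (simp add: coordinates_def s)
  qed
  have face_term: "frag_cmul ((-1) ^ Suc i) (image_chain q (\<lambda>P. s (face_vertex i False P)) -
        image_chain q (\<lambda>P. s (face_vertex i True P))) =
      frag_cmul (det ?M) (frag_cmul ((-1) ^ Suc (a i)) (?lo (a i) - ?up (a i)))"
    if "i < Suc q" for i
  proof -
    let ?\<delta> = "det (mat_delete ?M (a i) i)" and ?\<eta> = "if a i \<in> B then -1 else 1 :: int"
    have i: "i \<le> q" using that by simp
    have ai: "a i < Suc q" using a_less that .
    have "?M $$ (a i, j) = (if j = i then ?\<eta> else 0)" if "j < Suc q" for j
    proof -
      have "?M $$ (a i, j) = coordinates ks s {j} (a i) - coordinates ks s {} (a i)"
        using that ai by (simp add: edge_matrix_def)
      moreover have "a j = a i \<longleftrightarrow> j = i"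
        using bij that i by (auto simp: bij_betw_def inj_on_eq_iff)
      ultimately show ?thesis
        using coord[of "{j}" "a i"] coord[of "{}" "a i"] that ai by auto
    qed
    then have "det ?M = (\<Sum>j<Suc q. if j = i then ?\<eta> * cofactor ?M (a i) i else 0)"
      unfolding laplace_expansion_row[OF edge_matrix_carrier ai] by (intro sum.cong) auto
    also have "\<dots> = ?\<eta> * ((-1) ^ (a i + i) * ?\<delta>)"
      using that by (simp add: cofactor_def)
    finally have det: "(-1) ^ Suc (a i) * det ?M = ?\<eta> * (-1) ^ Suc i * ?\<delta>"
      by (simp add: power_add)
    have del: "frame w' (del (a i) ks)" "length (del (a i) ks) = q" if "length w' = length w" for w'
      using frame_del[OF w(1), of "a i"] length_del[of "a i" ks] ai w(2) that by auto
    have chain: "image_chain q (\<lambda>P. s (face_vertex i e P)) =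
        frag_cmul ?\<delta> (if (a i \<in> B) \<noteq> e then ?up (a i) else ?lo (a i))" for e
    proof -
      have "image_chain q (\<lambda>P. s (face_vertex i e P)) =
          frag_cmul ?\<delta> (frag_of (cube (if (a i \<in> B) \<noteq> e then w[ks ! a i := w ! (ks ! a i) + 1] else w)
             (del (a i) ks)))"
        unfolding face_matrix[OF iso w i, of e, symmetric]
        by (intro image_chain_onto face_image[OF iso w i]) (use del in auto)
      then show ?thesis by auto
    qed
    have "frag_cmul (det ?M) (frag_cmul ((-1) ^ Suc (a i)) (?lo (a i) - ?up (a i))) =
        frag_cmul (?\<eta> * (-1) ^ Suc i * ?\<delta>) (?lo (a i) - ?up (a i))"
      unfolding det[symmetric] by (simp add: mult.commute)
    also have "\<dots> = frag_cmul ((-1) ^ Suc i) (image_chain q (\<lambda>P. s (face_vertex i False P)) -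
        image_chain q (\<lambda>P. s (face_vertex i True P)))"
      unfolding chain by (intro poly_mapping_eqI) (auto simp: lookup_minus algebra_simps)
    finally show ?thesis ..
  qed
  have "image_chain (Suc q) s = frag_cmul (det ?M) (frag_of (cube w ks))"
    using signed_isometry_image[OF iso w] by (intro image_chain_onto w) (simp add: singular_image_def)
  then have "cube_boundary (image_chain (Suc q) s) =
      (\<Sum>r<Suc q. frag_cmul (det ?M) (frag_cmul ((-1) ^ Suc r) (?lo r - ?up r)))"
    by (simp only: cube_boundary_cmul cube_boundary_cube[OF w(1)] w(2) frag_cmul_sum)
  also have "\<dots> = (\<Sum>i<Suc q. frag_cmul (det ?M) (frag_cmul ((-1) ^ Suc (a i)) (?lo (a i) - ?up (a i))))"
    by (rule sum.reindex_bij_betw[OF bij, symmetric])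
  also have "\<dots> = (\<Sum>i<Suc q. frag_cmul ((-1) ^ Suc i) (image_chain q (\<lambda>P. s (face_vertex i False P)) -
        image_chain q (\<lambda>P. s (face_vertex i True P))))"
    by (rule sum.cong[OF refl]) (simp only: face_term lessThan_iff)
  finally show ?thesis by (simp only: lessThan_Suc_atMost)
qed

section \<open>Cancellation of faces on cubes that are not embedded\<close>

lemma frame_insort:
  assumes "frame w ks" "k < length w" "k \<notin> set ks" "length w' = length w"
  shows "frame w' (insort k ks)"
  using assms by (auto simp: frame_def strict_sorted_iff sorted_insort distinct_insort set_insort_key)

lemma cube_Un_cube:
  assumes len: "length w' = length w" and k: "k < length w" "k \<notin> set ks" "w' ! k = w ! k + 1"
    and eq: "\<And>j. j < length w \<Longrightarrow> j \<noteq> k \<Longrightarrow> w' ! j = w ! j"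
  shows "cube w ks \<union> cube w' ks = cube w (insort k ks)"
proof (rule Set.set_eqI)
  fix x
  have "x \<in> cube w ks \<longleftrightarrow> length x = length w \<and> x ! k = w ! k \<and>
      (\<forall>i<length w. i \<noteq> k \<longrightarrow> x ! i = w ! i \<or> i \<in> set ks \<and> x ! i = w ! i + 1)"
    using k by (auto simp: mem_cube_iff)
  moreover have "x \<in> cube w' ks \<longleftrightarrow> length x = length w \<and> x ! k = w ! k + 1 \<and>
      (\<forall>i<length w. i \<noteq> k \<longrightarrow> x ! i = w ! i \<or> i \<in> set ks \<and> x ! i = w ! i + 1)"
    using k len eq unfolding mem_cube_iff by metis
  moreover have "x \<in> cube w (insort k ks) \<longleftrightarrow> length x = length w \<and> (x ! k = w ! k \<or> x ! k = w ! k + 1) \<and>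
      (\<forall>i<length w. i \<noteq> k \<longrightarrow> x ! i = w ! i \<or> i \<in> set ks \<and> x ! i = w ! i + 1)"
    using k unfolding mem_cube_iff set_insort_key by auto
  ultimately show "x \<in> cube w ks \<union> cube w' ks \<longleftrightarrow> x \<in> cube w (insort k ks)"
    by blast
qed

lemma singular_image_Suc:
  "i \<le> q \<Longrightarrow> singular_image (Suc q) s =
     singular_image q (\<lambda>P. s (face_vertex i False P)) \<union> singular_image q (\<lambda>P. s (face_vertex i True P))"
proof (intro equalityI subsetI)
  fix x assume i: "i \<le> q" and "x \<in> singular_image (Suc q) s"
  then obtain P where P: "P \<subseteq> {..<Suc q}" "x = s P" by (auto simp: singular_image_def)
  obtain P' where P': "P' \<subseteq> {..<q}" "P = face_vertex i (i \<in> P) P'"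
    by (rule face_vertex_surj[OF P(1) i])
  have "x = s (face_vertex i (i \<in> P) P')" unfolding P'(2)[symmetric] by (rule P(2))
  then show "x \<in> singular_image q (\<lambda>P. s (face_vertex i False P)) \<union> singular_image q (\<lambda>P. s (face_vertex i True P))"
    using P'(1) by (cases "i \<in> P") (auto simp: singular_image_def)
qed (auto simp: singular_image_def intro!: imageI dest: face_vertex_subset)

text \<open>The bottom vertices of the two faces are joined by an edge, whose ends have images that
  differ in at most one coordinate, by 1. So \<open>w\<close> and \<open>w'\<close> differ in
  coordinate \<open>k\<close> alone, by 1, and the two image cubes are opposite faces of a larger
  elementary cube.\<close>

lemma opposite_faces_elementary:
  assumes s: "singular_cube (length w) (Suc q) s" and i: "i \<le> q"
    and w: "frame w ks" "length ks = q" and len: "length w' = length w"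
    and F: "singular_image q (\<lambda>P. s (face_vertex i e P)) = cube w ks"
    and T: "singular_image q (\<lambda>P. s (face_vertex i (\<not> e) P)) = cube w' ks"
    and agree: "\<And>j. j \<in> set ks \<Longrightarrow> w' ! j = w ! j"
    and k: "k < length w" "k \<notin> set ks" "w' ! k \<noteq> w ! k"
  shows "elementary_cube (singular_image (Suc q) s)" "cube_dim (singular_image (Suc q) s) = Suc q"
proof -
  define p where "p e' = s (face_vertex i e' {})" for e'
  have pF: "p e \<in> cube w ks" using F by (auto simp: p_def singular_image_def)
  have pT: "p (\<not> e) \<in> cube w' ks" using T by (auto simp: p_def singular_image_def)
  have "(\<Sum>j<length w. \<bar>p True ! j - p False ! j\<bar>) \<le> int (card (face_vertex i True {} - face_vertex i False {}))"
    unfolding p_def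
    by (rule cube_lipschitzD[OF singular_cube_lipschitz[OF s]]) (use i in \<open>auto simp: face_vertex_def\<close>)
  then have "(\<Sum>j<length w. \<bar>p True ! j - p False ! j\<bar>) \<le> 1"
    by (simp add: face_vertex_def)
  then have sum1: "(\<Sum>j<length w. \<bar>p (\<not> e) ! j - p e ! j\<bar>) \<le> 1"
    by (cases e) (auto simp: abs_minus_commute)
  have split: "(\<Sum>j<length w. \<bar>p (\<not> e) ! j - p e ! j\<bar>) =
      \<bar>p (\<not> e) ! k - p e ! k\<bar> + (\<Sum>j\<in>{..<length w} - {k}. \<bar>p (\<not> e) ! j - p e ! j\<bar>)"
    using k(1) by (intro sum.remove) auto
  have out: "p (\<not> e) ! j = w' ! j" "p e ! j = w ! j" if "j < length w" "j \<notin> set ks" for j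
    using pF pT that len by (auto simp: mem_cube_iff)
  have nn: "(\<Sum>j\<in>{..<length w} - {k}. \<bar>p (\<not> e) ! j - p e ! j\<bar>) \<ge> 0" by (simp add: sum_nonneg)
  have one: "\<bar>w' ! k - w ! k\<bar> = 1" and zero: "(\<Sum>j\<in>{..<length w} - {k}. \<bar>p (\<not> e) ! j - p e ! j\<bar>) = 0"
    using sum1 split nn k out[OF k(1,2)] by linarith+
  have eq: "w' ! j = w ! j" if "j < length w" "j \<noteq> k" for j
  proof (cases "j \<in> set ks")
    case False
    then show ?thesis using zero out[of j] that by (auto simp: sum_nonneg_eq_0_iff)
  qed (use agree in simp)
  have Un: "singular_image (Suc q) s = cube w ks \<union> cube w' ks"
    using singular_image_Suc[OF i, of s] F T by (cases e) auto
  \<comment> \<open>The witness is whichever of \<open>w\<close> and \<open>w'\<close> is smaller in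
    coordinate \<open>k\<close>.\<close>
  have "\<exists>u. length u = length w \<and> singular_image (Suc q) s = cube u (insort k ks)"
  proof (cases "w' ! k = w ! k + 1")
    case True
    then show ?thesis using cube_Un_cube[OF len k(1,2) True eq] Un by auto
  next
    case False
    then have "w ! k = w' ! k + 1" using one by linarith
    then have "cube w' ks \<union> cube w ks = cube w' (insort k ks)"
      using k(1,2) len eq by (intro cube_Un_cube) auto
    then show ?thesis using Un len by (intro exI[of _ w']) auto
  qed
  then obtain u where u: "length u = length w" "singular_image (Suc q) s = cube u (insort k ks)" by blast
  have "frame u (insort k ks)" using frame_insort[OF w(1) k(1,2) u(1)] .
  then show "elementary_cube (singular_image (Suc q) s)" "cube_dim (singular_image (Suc q) s) = Suc q"
    using u(2) w(2) by (simp_all add: elementary_cube_cube cube_dim_cube)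
qed

text \<open>If one face maps onto \<open>R\<close>, then any other face on which the cup product for \<open>R\<close> does not
  vanish maps onto a translate of \<open>R\<close> orthogonal to \<open>R\<close>. Faces with a common vertex have the same
  translate, and opposite faces with different translates make \<open>s\<close> an embedding. So the
  Stokes formula for the cup product is the vanishing of the coefficient of \<open>R\<close>.\<close>

lemma face_chain_degenerate:
  assumes s: "singular_cube n (Suc q) s"
    and deg: "\<not> (elementary_cube (singular_image (Suc q) s) \<and> cube_dim (singular_image (Suc q) s) = Suc q)"
  shows "(\<Sum>i\<le>q. frag_cmul ((-1) ^ Suc i) (image_chain q (\<lambda>P. s (face_vertex i False P)) -
                                        image_chain q (\<lambda>P. s (face_vertex i True P)))) = 0"
proof (rule poly_mapping_eqI)
  fix R
  let ?f = "\<lambda>i e P. s (face_vertex i e P)"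
  let ?L = "\<lambda>i e. poly_mapping.lookup (image_chain q (?f i e)) R"
  have "(\<Sum>i\<le>q. (-1) ^ i * (?L i True - ?L i False)) = 0"
  \<comment> \<open>The cup product also counts translates of \<open>R\<close>, and the argument
    that excludes them starts from a face onto \<open>R\<close> itself. Without such a face all
    coefficients are 0.\<close>
  proof (cases "elementary_cube R \<and> cube_dim R = q \<and> (\<exists>i\<le>q. \<exists>e. singular_image q (?f i e) = R)")
    case False
    then have "?L i e = 0" if "i \<le> q" for i e using that by (auto simp: lookup_image_chain)
    then show ?thesis by simp
  next
    case True
    obtain w ks where w: "frame w ks" and R: "R = cube w ks" using True elementary_cubeE by metis
    obtain i0 e0 where i0: "i0 \<le> q" "singular_image q (?f i0 e0) = cube w ks" using True R by auto
    have ks: "length ks = q" using True R cube_dim_cube[OF w] by simp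
    have sf: "singular_cube n q (?f i e)" if "i \<le> q" for i e using singular_cube_face[OF s that] .
    have "?f i0 e0 {} \<in> cube w ks" using i0(2) by (auto simp: singular_image_def)
    then have n: "n = length w"
      using sf[OF i0(1), of e0] by (auto simp: mem_cube_iff singular_cube_def)
    have cup: "?L i e = cup_form q (threshold w ks (?f i e))" if i: "i \<le> q" for i e
    proof (cases "singular_image q (?f i e) = R")
      case True
      then have "?L i e = det (edge_matrix q (coordinates ks (?f i e)))"
        unfolding R by (simp add: lookup_image_chain elementary_cube_cube cube_dim_cube[OF w] ks nondeg_dirs_cube[OF w])
      then show ?thesis
        using singular_cube_onto(2)[of w q "?f i e" ks] sf[OF i] w ks True
        by (simp add: n R singular_image_def coordinates_def[abs_def])
    next
      case False
      have "cup_form q (threshold w ks (?f i e)) = 0"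
      proof (rule ccontr)
        assume nz: "cup_form q (threshold w ks (?f i e)) \<noteq> 0"
        obtain w' B a where w': "length w' = length w" "\<And>j. j \<in> set ks \<Longrightarrow> w' ! j = w ! j"
          and iso: "signed_isometry q (?f i e) w' ks B a"
          using threshold_cup_form_nonzero[OF sf[OF i, of e, unfolded n] w ks nz] by blast
        have fw': "frame w' ks" using w w'(1) by (simp add: frame_def)
        have im: "singular_image q (?f i e) = cube w' ks"
          using signed_isometry_image[OF iso fw' ks] by (simp add: singular_image_def)
        then have "w' \<noteq> w" using False R by auto
        then obtain k where k: "k < length w" "w' ! k \<noteq> w ! k"
          using w'(1) by (metis nth_equalityI)
        then have k': "k \<notin> set ks" using w'(2) by auto
        have val: "s P ! k = w' ! k" if P: "P \<subseteq> {..<Suc q}" "i \<in> P \<longleftrightarrow> e" for P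
        proof -
          obtain P' where P': "P' \<subseteq> {..<q}" "P = face_vertex i (i \<in> P) P'"
            by (rule face_vertex_surj[OF P(1) i])
          have "s P = ?f i e P'" by (rule arg_cong[OF P'(2)[unfolded P(2)]])
          then have "s P \<in> cube w' ks" using im P'(1) by (auto simp: singular_image_def)
          then show ?thesis using k k' w'(1) by (auto simp: mem_cube_iff)
        qed
        have val0: "s P ! k = w ! k" if P: "P \<subseteq> {..<Suc q}" "i0 \<in> P \<longleftrightarrow> e0" for P
        proof -
          obtain P' where P': "P' \<subseteq> {..<q}" "P = face_vertex i0 (i0 \<in> P) P'"
            by (rule face_vertex_surj[OF P(1) i0(1)])
          have "s P = ?f i0 e0 P'" by (rule arg_cong[OF P'(2)[unfolded P(2)]])
          then have "s P \<in> cube w ks" using i0(2) P'(1) by (auto simp: singular_image_def)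
          then show ?thesis using k k' by (auto simp: mem_cube_iff)
        qed
        have "i = i0 \<and> e \<noteq> e0"
        proof (rule ccontr)
          assume c: "\<not> (i = i0 \<and> e \<noteq> e0)"
          \<comment> \<open>A vertex common to both faces, which exists unless they are opposite;
            coordinate \<open>k\<close> would have two values there.\<close>
          let ?P = "(if e then {i} else {}) \<union> (if e0 then {i0} else {})"
          have "?P \<subseteq> {..<Suc q}" "i \<in> ?P \<longleftrightarrow> e" "i0 \<in> ?P \<longleftrightarrow> e0" using c i i0(1) by auto
          then show False using val[of ?P] val0[of ?P] k(2) by simp
        qed
        then have "i = i0" "e = (\<not> e0)" by auto
        then show False
          using opposite_faces_elementary[of w q s i0 ks w' e0 k] s n i0 w ks w' im k k' deg by auto
      qed
      then show ?thesis using False by (simp add: lookup_image_chain)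
    qed
    have "threshold w ks (?f i e) = (\<lambda>P. threshold w ks s (face_vertex i e P))" for i e
      by (auto simp: threshold_def fun_eq_iff)
    then show ?thesis
      using cup_form_stokes[of q "threshold w ks s"] by (simp add: cup)
  qed
  then have "(\<Sum>i\<le>q. (-1) ^ Suc i * (?L i False - ?L i True)) = 0"
    by (simp add: sum_negf algebra_simps)
  then show "poly_mapping.lookup (\<Sum>i\<le>q. frag_cmul ((-1) ^ Suc i) (image_chain q (?f i False) -
      image_chain q (?f i True))) R = poly_mapping.lookup 0 R"
    by (simp add: lookup_sum lookup_minus)
qed

text \<open>The single formula behind the chain map property and the chain homotopy: cubes of the
  domain and prisms both give singular cubes.\<close>

lemma cube_boundary_image_chain:
  assumes s: "singular_cube n (Suc q) s"
  shows "cube_boundary (image_chain (Suc q) s) =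
    (\<Sum>i\<le>q. frag_cmul ((-1) ^ Suc i) (image_chain q (\<lambda>P. s (face_vertex i False P)) -
                                        image_chain q (\<lambda>P. s (face_vertex i True P))))"
proof (cases "elementary_cube (singular_image (Suc q) s) \<and> cube_dim (singular_image (Suc q) s) = Suc q")
  case True
  then obtain w ks where w: "frame w ks" and R: "singular_image (Suc q) s = cube w ks"
    using elementary_cubeE by metis
  have ks: "length ks = Suc q" using True R cube_dim_cube[OF w] by simp
  have "s {} \<in> cube w ks" using R by (auto simp: singular_image_def)
  then have "n = length w" using s by (auto simp: mem_cube_iff singular_cube_def)
  then obtain B a where "signed_isometry (Suc q) s w ks B a"
    using singular_cube_onto(1)[of w "Suc q" s ks] s w ks R by (auto simp: singular_image_def)
  then show ?thesis using w ks by (rule cube_boundary_image_chain_isometry)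
next
  case False
  then have "image_chain (Suc q) s = 0" by (auto simp: image_chain_def Let_def)
  then show ?thesis using face_chain_degenerate[OF s False] by (simp add: cube_boundary_def)
qed

lemma cube_boundary_image_chain_0: "cube_boundary (image_chain 0 s) = 0"
  by (simp add: image_chain_def Let_def cube_boundary_cmul) (simp add: cube_boundary_def)

section \<open>Chain maps and chain homotopies\<close>

lemma c1_adj_vertex_insert:
  assumes "frame v js" "U \<subseteq> {..<length js}" "j < length js" "j \<notin> U"
  shows "c1_adj (vertex v js U) (vertex v js (insert j U))"
  unfolding c1_adj_def
proof (intro conjI exI[of _ "js ! j"] allI impI)
  have "insert j U \<subseteq> {..<length js}" using assms by auto
  then show "\<bar>vertex v js U ! (js ! j) - vertex v js (insert j U) ! (js ! j)\<bar> = 1"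
    using nth_vertex[OF assms(1,2,3)] nth_vertex[OF assms(1) _ assms(3)] assms(4) by simp
  fix k assume "k < length (vertex v js U)" "k \<noteq> js ! j"
  then show "vertex v js U ! k = vertex v js (insert j U) ! k" by (simp add: vertex_def)
qed (use frame_nth_less[OF assms(1,3)] in simp_all)

lemma vertex_in_cube: "frame v js \<Longrightarrow> U \<subseteq> {..<length js} \<Longrightarrow> vertex v js U \<in> cube v js"
  using vertex_image by blast

lemma singular_cube_comp_vertex:
  assumes "c1_continuous X Y f" "Y \<subseteq> int_lattice n" "frame v js" "cube v js \<subseteq> X"
  shows "singular_cube n (length js) (f \<circ> vertex v js)"
  unfolding singular_cube_def
proof (intro conjI allI impI)
  fix P assume P: "P \<subseteq> {..<length js}"
  have vX: "vertex v js P \<in> X" if "P \<subseteq> {..<length js}" for P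
    using vertex_in_cube[OF assms(3) that] assms(4) by blast
  then have "f (vertex v js P) \<in> Y" using assms(1) P by (auto simp: digital_continuous_def)
  then show "length ((f \<circ> vertex v js) P) = n" using assms(2) by (auto simp: int_lattice_def)
  fix j assume j: "j < length js" "j \<notin> P"
  then have "insert j P \<subseteq> {..<length js}" using P by auto
  then show "(f \<circ> vertex v js) (insert j P) = (f \<circ> vertex v js) P \<or>
      c1_adj ((f \<circ> vertex v js) P) ((f \<circ> vertex v js) (insert j P))"
    using assms(1) vX P c1_adj_vertex_insert[OF assms(3) P j]
    unfolding digital_continuous_def comp_def by metis
qed

lemma carrier_cube_chain_group:
  "c \<in> carrier (cube_chain_group q X) \<longleftrightarrow>
     Poly_Mapping.keys c \<subseteq> {Q. elementary_cube Q \<and> cube_dim Q = q \<and> Q \<subseteq> X}"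
  by (simp add: cube_chain_group_def)

lemma cube_chain_induct [consumes 1, case_names zero cube diff]:
  assumes "c \<in> carrier (cube_chain_group q X)" "P 0"
    and "\<And>v js. frame v js \<Longrightarrow> length js = q \<Longrightarrow> cube v js \<subseteq> X \<Longrightarrow> P (frag_of (cube v js))"
    and "\<And>a b. P a \<Longrightarrow> P b \<Longrightarrow> P (a - b)"
  shows "P c"
  using assms(1)[unfolded carrier_cube_chain_group]
proof (induction c rule: frag_induction)
  case (one Q)
  then obtain v js where "frame v js" "Q = cube v js" using elementary_cubeE by auto
  then show ?case using one assms(3) cube_dim_cube by auto
qed (use assms in auto)

lemma cube_chain_diff:
  "a \<in> carrier (cube_chain_group q X) \<Longrightarrow> b \<in> carrier (cube_chain_group q X) \<Longrightarrow>
     a - b \<in> carrier (cube_chain_group q X)"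
  unfolding carrier_cube_chain_group using Poly_Mapping.keys_diff[of a b] by blast

lemma cube_chain_zero: "0 \<in> carrier (cube_chain_group q X)"
  by (simp add: carrier_cube_chain_group)

lemma cube_chain_sum:
  "(\<And>i. i \<in> I \<Longrightarrow> c i \<in> carrier (cube_chain_group q X)) \<Longrightarrow>
     sum c I \<in> carrier (cube_chain_group q X)"
  unfolding cube_chain_group_def by (rule sum_closed_free_Abelian_group)

lemma image_chain_in:
  assumes "singular_image q s \<subseteq> Y"
  shows "image_chain q s \<in> carrier (cube_chain_group q Y)"
  using assms by (auto simp: carrier_cube_chain_group image_chain_def Let_def keys_frag_of
      dest!: subsetD[OF keys_cmul])

lemma cube_boundary_0 [simp]: "cube_boundary 0 = 0"
  by (simp add: cube_boundary_def)

lemma cube_boundary_diff: "cube_boundary (a - b) = cube_boundary a - cube_boundary b"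
  by (simp add: cube_boundary_def frag_extend_diff)

lemma cube_boundary_sum: "finite I \<Longrightarrow> cube_boundary (sum c I) = (\<Sum>i\<in>I. cube_boundary (c i))"
  by (simp add: cube_boundary_def frag_extend_sum)

lemma frag_cmul_diff: "frag_cmul c (a - b) = frag_cmul c a - frag_cmul c b"
  by (rule poly_mapping_eqI) (simp add: lookup_minus right_diff_distrib)

lemma cube_map_0 [simp]: "cube_map f 0 = 0"
  by (simp add: cube_map_def)

lemma cube_map_diff: "cube_map f (a - b) = cube_map f a - cube_map f b"
  by (simp add: cube_map_def frag_extend_diff)

lemma cube_map_cmul: "cube_map f (frag_cmul k a) = frag_cmul k (cube_map f a)"
  by (simp add: cube_map_def frag_extend_cmul)

lemma cube_map_sum: "finite I \<Longrightarrow> cube_map f (sum c I) = (\<Sum>i\<in>I. cube_map f (c i))"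
  by (simp add: cube_map_def frag_extend_sum)

lemma singular_image_comp_vertex:
  "frame v js \<Longrightarrow> singular_image (length js) (f \<circ> vertex v js) = f ` cube v js"
  unfolding singular_image_def using vertex_image[of v js] by (metis image_comp)

text \<open>On one cube this is \<open>cube_boundary_image_chain\<close> for
  \<open>f \<circ> vertex v js\<close>, because restricting to a face of the standard cube amounts
  to restricting \<open>f\<close> to a face of the cube.\<close>

lemma cube_chain_map_cube_map:
  assumes f: "c1_continuous X Y f" and Y: "Y \<subseteq> int_lattice n"
  shows "cube_chain_map X Y (cube_map f)"
proof -
  have fXY: "f ` X \<subseteq> Y" using f by (auto simp: digital_continuous_def)
  have mem: "cube_map f c \<in> carrier (cube_chain_group q Y)" if "c \<in> carrier (cube_chain_group q X)" for c q
    using that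
  proof (induction c rule: cube_chain_induct)
    case (cube v js)
    have "singular_image (length js) (f \<circ> vertex v js) \<subseteq> Y"
      unfolding singular_image_comp_vertex[OF cube(1)] using fXY cube(3) by blast
    then show ?case using image_chain_in cube by (simp add: cube_map_cube)
  qed (simp_all add: cube_chain_zero cube_map_diff cube_chain_diff)
  have "cube_map f \<in> hom (cube_chain_group q X) (cube_chain_group q Y)" for q
    by (rule homI) (use mem in \<open>auto simp: cube_chain_group_def cube_map_def frag_extend_add\<close>)
  moreover have "cube_boundary (cube_map f c) = cube_map f (cube_boundary c)"
    if "c \<in> carrier (cube_chain_group q X)" for c q
    using that
  proof (induction c rule: cube_chain_induct)
    case (cube v js)
    show ?case
    proof (cases q)
      case 0
      then show ?thesis
        using cube by (simp add: cube_map_cube cube_boundary_image_chain_0 cube_boundary_cube)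
    next
      case (Suc q')
      let ?s = "f \<circ> vertex v js"
      have len: "length js = Suc q'" using cube Suc by simp
      have lo: "cube_map f (frag_of (cube v (del i js))) = image_chain q' (\<lambda>P. ?s (face_vertex i False P))"
        and up: "cube_map f (frag_of (cube (v[js ! i := v ! (js ! i) + 1]) (del i js))) =
            image_chain q' (\<lambda>P. ?s (face_vertex i True P))" if "i \<le> q'" for i
      proof -
        have i: "i < length js" using that len by simp
        have *: "cube_map f (frag_of (cube w (del i js))) = image_chain q' (f \<circ> vertex w (del i js))"
          if "length w = length v" for w
          using cube_map_cube[OF frame_del[OF cube(1) i that]] length_del[OF i] len by simp
        show "cube_map f (frag_of (cube v (del i js))) = image_chain q' (\<lambda>P. ?s (face_vertex i False P))"
          unfolding *[OF refl] using len vertex_face_vertex_False[OF i]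
          by (intro image_chain_cong) simp
        show "cube_map f (frag_of (cube (v[js ! i := v ! (js ! i) + 1]) (del i js))) =
            image_chain q' (\<lambda>P. ?s (face_vertex i True P))"
          unfolding *[OF length_list_update] using len vertex_face_vertex_True[OF cube(1) i]
          by (intro image_chain_cong) simp
      qed
      have "cube_boundary (cube_map f (frag_of (cube v js))) =
        (\<Sum>i\<le>q'. frag_cmul ((-1) ^ Suc i) (image_chain q' (\<lambda>P. ?s (face_vertex i False P)) -
                                        image_chain q' (\<lambda>P. ?s (face_vertex i True P))))"
        unfolding cube_map_cube[OF cube(1)] len
        by (rule cube_boundary_image_chain)
          (use singular_cube_comp_vertex[OF f Y cube(1,3)] len in simp)
      also have "\<dots> = cube_map f (cube_boundary (frag_of (cube v js)))"
        unfolding cube_boundary_cube[OF cube(1)] cube_map_sum[OF finite_atMost] cube_map_cmul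
          cube_map_diff len lessThan_Suc_atMost
        by (intro sum.cong refl) (simp only: lo up atMost_iff)
      finally show ?thesis .
    qed
  qed (simp_all add: cube_boundary_diff cube_map_diff)
  ultimately show ?thesis by (simp add: cube_chain_map_def)
qed

section \<open>The prism operator of a homotopy\<close>

definition prism_cube ::
    "(int list \<Rightarrow> int \<Rightarrow> int list) \<Rightarrow> nat \<Rightarrow> int list \<Rightarrow> nat list \<Rightarrow> nat set \<Rightarrow> int list" where
  "prism_cube H t v js P = H (vertex v js (P \<inter> {..<length js})) (int t + of_bool (length js \<in> P))"

text \<open>The chain homotopy, with one summand for each unit of time. Time is the last direction
  of \<open>prism_cube\<close>, so the side faces keep the indices and signs of the faces of
  \<open>Q\<close>, and the ends carry \<open>(-1) ^ Suc q\<close> for a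
  \<open>q\<close>-cube.\<close>

definition prism :: "nat \<Rightarrow> (int list \<Rightarrow> int \<Rightarrow> int list) \<Rightarrow> (int list set \<Rightarrow>\<^sub>0 int) \<Rightarrow> (int list set \<Rightarrow>\<^sub>0 int)" where
  "prism k H = frag_extend (\<lambda>Q. \<Sum>t<k.
     image_chain (Suc (cube_dim Q)) (prism_cube H t (map Min (factors Q)) (nondeg_dirs Q)))"

lemma prism_0 [simp]: "prism k H 0 = 0"
  by (simp add: prism_def)

lemma prism_diff: "prism k H (a - b) = prism k H a - prism k H b"
  by (simp add: prism_def frag_extend_diff)

lemma prism_cmul: "prism k H (frag_cmul c a) = frag_cmul c (prism k H a)"
  by (simp add: prism_def frag_extend_cmul)

lemma prism_sum: "finite I \<Longrightarrow> prism k H (sum c I) = (\<Sum>i\<in>I. prism k H (c i))"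
  by (simp add: prism_def frag_extend_sum)

lemma prism_frag_of_cube:
  "frame v js \<Longrightarrow> prism k H (frag_of (cube v js)) =
     (\<Sum>t<k. image_chain (Suc (length js)) (prism_cube H t v js))"
  by (simp add: prism_def cube_dim_cube nondeg_dirs_cube map_Min_factors_cube)

context
  fixes X Y :: "int list set" and n k :: nat and H :: "int list \<Rightarrow> int \<Rightarrow> int list"
  assumes Y: "Y \<subseteq> int_lattice n"
    and track: "\<And>x. x \<in> X \<Longrightarrow> digital_continuous {0..int k} (\<lambda>s t. \<bar>s - t\<bar> = 1) Y c1_adj (H x)"
    and stage: "\<And>t. t \<in> {0..int k} \<Longrightarrow> c1_continuous X Y (\<lambda>x. H x t)"
begin

lemma prism_cube_in:
  assumes "frame v js" "cube v js \<subseteq> X" "t < k"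
  shows "prism_cube H t v js P \<in> Y"
proof -
  have "vertex v js (P \<inter> {..<length js}) \<in> X"
    using vertex_in_cube[OF assms(1), of "P \<inter> {..<length js}"] assms(2) by auto
  moreover have "int t + of_bool (length js \<in> P) \<in> {0..int k}" using assms(3) by auto
  ultimately show ?thesis
    using track unfolding prism_cube_def digital_continuous_def by blast
qed

text \<open>An edge of the prism changes either the point or the time but never both, so continuity
  in each variable separately suffices.\<close>

lemma singular_cube_prism_cube:
  assumes v: "frame v js" "cube v js \<subseteq> X" and t: "t < k"
  shows "singular_cube n (Suc (length js)) (prism_cube H t v js)"
  unfolding singular_cube_def
proof (intro conjI allI impI)
  fix P assume "P \<subseteq> {..<Suc (length js)}"
  let ?q = "length js" and ?s = "prism_cube H t v js"
  let ?R = "P \<inter> {..<?q}" and ?t = "int t + of_bool (length js \<in> P)"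
  show "length (?s P) = n"
    using prism_cube_in[OF assms] Y by (auto simp: int_lattice_def)
  have X: "vertex v js U \<in> X" if "U \<subseteq> {..<?q}" for U
    using vertex_in_cube[OF v(1) that] v(2) by blast
  have t01: "?t \<in> {0..int k}" using t by auto
  fix j assume j: "j < Suc ?q" "j \<notin> P"
  show "?s (insert j P) = ?s P \<or> c1_adj (?s P) (?s (insert j P))"
  proof (cases "j = ?q")
    case True
    then have "insert j P \<inter> {..<?q} = ?R" "?s (insert j P) = H (vertex v js ?R) (int t + 1)"
      "?s P = H (vertex v js ?R) (int t)"
      using j by (auto simp: prism_cube_def)
    moreover have "H (vertex v js ?R) (int t) = H (vertex v js ?R) (int t + 1) \<or>
        c1_adj (H (vertex v js ?R) (int t)) (H (vertex v js ?R) (int t + 1))"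
      using track[OF X, of ?R] t unfolding digital_continuous_def by auto
    ultimately show ?thesis by metis
  next
    case False
    then have jq: "j < ?q" "j \<notin> ?R" using j by auto
    then have ins: "insert j P \<inter> {..<?q} = insert j ?R" "?q \<in> insert j P \<longleftrightarrow> ?q \<in> P" by auto
    have "c1_adj (vertex v js ?R) (vertex v js (insert j ?R))"
      using jq by (intro c1_adj_vertex_insert[OF v(1)]) auto
    moreover have "vertex v js ?R \<in> X" "vertex v js (insert j ?R) \<in> X" using X jq by auto
    ultimately have "H (vertex v js ?R) ?t = H (vertex v js (insert j ?R)) ?t \<or>
        c1_adj (H (vertex v js ?R) ?t) (H (vertex v js (insert j ?R)) ?t)"
      using stage[OF t01] unfolding digital_continuous_def by blast
    moreover have "?s P = H (vertex v js ?R) ?t" "?s (insert j P) = H (vertex v js (insert j ?R)) ?t"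
      unfolding prism_cube_def ins by simp_all
    ultimately show ?thesis by metis
  qed
qed

lemma prism_in:
  assumes "c \<in> carrier (cube_chain_group q X)"
  shows "prism k H c \<in> carrier (cube_chain_group (Suc q) Y)"
  using assms
proof (induction c rule: cube_chain_induct)
  case (cube v js)
  have "image_chain (Suc q) (prism_cube H t v js) \<in> carrier (cube_chain_group (Suc q) Y)" if "t < k" for t
    using prism_cube_in[OF cube(1,3) that] by (intro image_chain_in) (auto simp: singular_image_def)
  then show ?case
    using cube by (auto simp: prism_frag_of_cube intro!: cube_chain_sum)
qed (simp_all add: cube_chain_zero prism_diff cube_chain_diff)

lemma prism_cube_side_face:
  assumes v: "frame v js" and i: "i < length js"
  shows "image_chain (length js) (\<lambda>P. prism_cube H t v js (face_vertex i e P)) =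
    image_chain (length js) (prism_cube H t (if e then v[js ! i := v ! (js ! i) + 1] else v) (del i js))"
proof (rule image_chain_cong)
  fix P assume P: "P \<subseteq> {..<length js}"
  obtain q where q: "length js = Suc q" using i by (cases "length js") auto
  have len: "length (del i js) = q" using length_del[OF i] q by simp
  have "face_vertex i e P \<inter> {..<Suc q} = face_vertex i e (P \<inter> {..<q})"
    "Suc q \<in> face_vertex i e P \<longleftrightarrow> q \<in> P"
    using i q by (auto simp: face_vertex_def insert_index_def split: if_splits)
  moreover have "vertex v js (face_vertex i e (P \<inter> {..<q})) =
      vertex (if e then v[js ! i := v ! (js ! i) + 1] else v) (del i js) (P \<inter> {..<q})"
    using vertex_face_vertex_False[OF i] vertex_face_vertex_True[OF v i] q by (cases e) auto
  ultimately show "prism_cube H t v js (face_vertex i e P) =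
      prism_cube H t (if e then v[js ! i := v ! (js ! i) + 1] else v) (del i js) P"
    by (simp add: prism_cube_def q len)
qed

lemma prism_cube_end_face:
  "image_chain (length js) (\<lambda>P. prism_cube H t v js (face_vertex (length js) e P)) =
    image_chain (length js) (\<lambda>P. H (vertex v js P) (int t + of_bool e))"
proof (rule image_chain_cong)
  fix P assume P: "P \<subseteq> {..<length js}"
  then have "face_vertex (length js) e P \<inter> {..<length js} = P" 
    "length js \<in> face_vertex (length js) e P \<longleftrightarrow> e"
    by (auto simp: face_vertex_def insert_index_def image_iff subset_iff)
  then show "prism_cube H t v js (face_vertex (length js) e P) = H (vertex v js P) (int t + of_bool e)"
    by (simp add: prism_cube_def)
qed

text \<open>The sides of the prisms add up to the prism over the boundary, with a plus sign because
  time comes last. The ends telescope over time, leaving the images under \<open>f\<close> and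
  \<open>g\<close>.\<close>

lemma cube_boundary_prism:
  assumes "c \<in> carrier (cube_chain_group q X)"
    and H0: "\<And>x. x \<in> X \<Longrightarrow> H x 0 = f x" and Hk: "\<And>x. x \<in> X \<Longrightarrow> H x (int k) = g x"
  shows "cube_boundary (prism k H c) =
    prism k H (cube_boundary c) + frag_cmul ((-1) ^ Suc q) (cube_map f c - cube_map g c)"
  using assms(1)
proof (induction c rule: cube_chain_induct)
  case (cube v js)
  note v = cube(1) and X = cube(3)
  have q: "q = length js" using cube by simp
  let ?I = "\<lambda>t v' js'. image_chain q (prism_cube H t v' js')"
  let ?up = "\<lambda>i. v[js ! i := v ! (js ! i) + 1]"
  define M where "M t = image_chain q (\<lambda>P. H (vertex v js P) (int t))" for t
  have bd: "cube_boundary (image_chain (Suc q) (prism_cube H t v js)) =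
      (\<Sum>i<q. frag_cmul ((-1) ^ Suc i) (?I t v (del i js) - ?I t (?up i) (del i js))) +
      frag_cmul ((-1) ^ Suc q) (M t - M (Suc t))" if "t < k" for t
  proof -
    have "cube_boundary (image_chain (Suc q) (prism_cube H t v js)) =
      (\<Sum>i<Suc q. frag_cmul ((-1) ^ Suc i)
         (image_chain q (\<lambda>P. prism_cube H t v js (face_vertex i False P)) -
          image_chain q (\<lambda>P. prism_cube H t v js (face_vertex i True P))))"
      unfolding lessThan_Suc_atMost
      by (rule cube_boundary_image_chain) (use singular_cube_prism_cube[OF v X that] q in simp)
    also have "\<dots> = (\<Sum>i<q. frag_cmul ((-1) ^ Suc i)
         (image_chain q (\<lambda>P. prism_cube H t v js (face_vertex i False P)) -
          image_chain q (\<lambda>P. prism_cube H t v js (face_vertex i True P)))) +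
        frag_cmul ((-1) ^ Suc q)
         (image_chain q (\<lambda>P. prism_cube H t v js (face_vertex q False P)) -
          image_chain q (\<lambda>P. prism_cube H t v js (face_vertex q True P)))"
      by (rule sum.lessThan_Suc)
    also have "(\<Sum>i<q. frag_cmul ((-1) ^ Suc i)
         (image_chain q (\<lambda>P. prism_cube H t v js (face_vertex i False P)) -
          image_chain q (\<lambda>P. prism_cube H t v js (face_vertex i True P)))) =
        (\<Sum>i<q. frag_cmul ((-1) ^ Suc i) (?I t v (del i js) - ?I t (?up i) (del i js)))"
      by (rule sum.cong[OF refl]) (simp add: q prism_cube_side_face[OF v])
    also have "image_chain q (\<lambda>P. prism_cube H t v js (face_vertex q False P)) = M t"
      unfolding q prism_cube_end_face by (simp add: M_def q)
    also have "image_chain q (\<lambda>P. prism_cube H t v js (face_vertex q True P)) = M (Suc t)"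
      unfolding q prism_cube_end_face by (simp add: M_def q add.commute)
    finally show ?thesis .
  qed
  have side: "prism k H (frag_of (cube w (del i js))) = (\<Sum>t<k. ?I t w (del i js))"
    if "i < q" "length w = length v" for w i
  proof -
    have i: "i < length js" using that q by simp
    then have "Suc (length (del i js)) = q" using length_del[OF i] q by simp
    then show ?thesis using prism_frag_of_cube[OF frame_del[OF v i that(2)], of k H] by simp
  qed
  have "cube_boundary (prism k H (frag_of (cube v js))) =
      (\<Sum>t<k. cube_boundary (image_chain (Suc q) (prism_cube H t v js)))"
    unfolding prism_frag_of_cube[OF v] q by (rule cube_boundary_sum) simp
  also have "\<dots> = (\<Sum>t<k. (\<Sum>i<q. frag_cmul ((-1) ^ Suc i) (?I t v (del i js) - ?I t (?up i) (del i js))) +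
      frag_cmul ((-1) ^ Suc q) (M t - M (Suc t)))"
    by (rule sum.cong[OF refl], rule bd) simp
  also have "\<dots> = (\<Sum>i<q. \<Sum>t<k. frag_cmul ((-1) ^ Suc i) (?I t v (del i js) - ?I t (?up i) (del i js))) +
      frag_cmul ((-1) ^ Suc q) (\<Sum>t<k. M t - M (Suc t))"
    unfolding sum.distrib frag_cmul_sum by (subst sum.swap) (rule refl)
  also have "(\<Sum>t<k. M t - M (Suc t)) = M 0 - M k"
    by (rule sum_lessThan_telescope')
  also have "(\<Sum>i<q. \<Sum>t<k. frag_cmul ((-1) ^ Suc i) (?I t v (del i js) - ?I t (?up i) (del i js))) =
      prism k H (cube_boundary (frag_of (cube v js)))"
    unfolding cube_boundary_cube[OF v] prism_sum[OF finite_lessThan] prism_cmul prism_diff q[symmetric]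
    by (intro sum.cong refl) (simp only: side lessThan_iff length_list_update frag_cmul_sum[symmetric] sum_subtractf)
  also have "M 0 = cube_map f (frag_of (cube v js))"
    unfolding M_def q cube_map_cube[OF v]
    using vertex_in_cube[OF v] X H0 by (intro image_chain_cong) auto
  also have "M k = cube_map g (frag_of (cube v js))"
    unfolding M_def q cube_map_cube[OF v]
    using vertex_in_cube[OF v] X Hk by (intro image_chain_cong) auto
  finally show ?case .
next
  case (diff a b)
  show ?case
    unfolding prism_diff cube_boundary_diff cube_map_diff frag_cmul_diff diff
    by (simp only: algebra_simps)
qed simp

end

section \<open>Passage to homology classes\<close>

lemma cube_homologyE:
  assumes "K \<in> carrier (cube_homology_group q X)"
  obtains z where "z \<in> cube_cycles q X" "K = cube_boundaries q X #>\<^bsub>cube_chain_group q X\<^esub> z"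
proof -
  let ?C = "cube_chain_group q X"
  \<comment> \<open>The homology group is a quotient of the subgroup generated by the cycles; to
    obtain a cycle as representative, the generated subgroup must be identified with the set of
    cycles.\<close>
  have "subgroup (cube_cycles q X) ?C"
  proof (rule group.subgroupI)
    show "group ?C" by (simp add: cube_chain_group_def)
    show "cube_cycles q X \<noteq> {}" by (auto simp: cube_cycles_def intro!: exI[of _ 0] cube_chain_zero)
    fix a assume a: "a \<in> cube_cycles q X"
    then have "inv\<^bsub>?C\<^esub> a = 0 - a"
      by (simp add: cube_cycles_def cube_chain_group_def)
    moreover have "0 - a \<in> cube_cycles q X"
      using a cube_chain_diff[OF cube_chain_zero] cube_boundary_diff[of 0 a]
      by (auto simp: cube_cycles_def)
    ultimately show "inv\<^bsub>?C\<^esub> a \<in> cube_cycles q X" by simp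
    fix b assume b: "b \<in> cube_cycles q X"
    have "a \<otimes>\<^bsub>?C\<^esub> b = a - (0 - b)" by (simp add: cube_chain_group_def)
    moreover have "a - (0 - b) \<in> cube_cycles q X"
      using a b cube_chain_diff[OF _ cube_chain_diff[OF cube_chain_zero]]
        cube_boundary_diff[of a "0 - b"] cube_boundary_diff[of 0 b]
      by (auto simp: cube_cycles_def)
    ultimately show "a \<otimes>\<^bsub>?C\<^esub> b \<in> cube_cycles q X" by simp
  qed (auto simp: cube_cycles_def)
  then have "carrier (subgroup_generated ?C (cube_cycles q X)) = cube_cycles q X"
    by (rule subgroup.carrier_subgroup_generated_subgroup)
  moreover obtain z where "z \<in> carrier (subgroup_generated ?C (cube_cycles q X))"
    "K = cube_boundaries q X #>\<^bsub>subgroup_generated ?C (cube_cycles q X)\<^esub> z"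
    using assms by (auto simp: cube_homology_group_def FactGroup_def RCOSETS_def)
  ultimately show ?thesis
    using that[of z] by (simp add: r_coset_def subgroup_generated_def)
qed

lemma cube_boundaries_coset_eq:
  assumes "x - y \<in> cube_boundaries q Y"
  shows "cube_boundaries q Y #>\<^bsub>cube_chain_group q Y\<^esub> x =
    cube_boundaries q Y #>\<^bsub>cube_chain_group q Y\<^esub> y"
proof -
  have diff: "a - b \<in> cube_boundaries q Y" if "a \<in> cube_boundaries q Y" "b \<in> cube_boundaries q Y" for a b
    using that by (auto simp: cube_boundaries_def cube_boundary_diff[symmetric] intro!: imageI cube_chain_diff)
  have "0 \<in> cube_boundaries q Y"
    using cube_boundary_0 cube_chain_zero unfolding cube_boundaries_def by (metis imageI)
  then have neg: "y - x \<in> cube_boundaries q Y" using diff[of 0 "x - y"] assms by simp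
  have sub: "\<exists>c\<in>cube_boundaries q Y. b + x' = c + y'"
    if "b \<in> cube_boundaries q Y" "y' - x' \<in> cube_boundaries q Y" for b x' y'
    using diff[OF that] by (intro bexI[of _ "b - (y' - x')"]) (simp_all add: algebra_simps)
  show ?thesis
    using sub[OF _ neg] sub[OF _ assms] by (auto simp: r_coset_def cube_chain_group_def)
qed

lemma homotopic_cube_induced_eq:
  assumes "Y \<subseteq> int_lattice n" "c1_continuous X Y f" "c1_continuous X Y g" "c1_homotopic X Y f g"
  shows "cube_induced q X Y f = cube_induced q X Y g"
proof
  fix K
  obtain k' :: int and H where k': "0 < k'" and H: "\<And>x. x \<in> X \<Longrightarrow> H x 0 = f x" "\<And>x. x \<in> X \<Longrightarrow> H x k' = g x"
    "\<And>x. x \<in> X \<Longrightarrow> digital_continuous {0..k'} (\<lambda>s t. \<bar>s - t\<bar> = 1) Y c1_adj (H x)"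
    "\<And>t. t \<in> {0..k'} \<Longrightarrow> c1_continuous X Y (\<lambda>x. H x t)"
    using assms(4) unfolding digital_homotopic_def by blast
  obtain k where k: "k' = int k" using k' by (metis int_nat_eq less_imp_le)
  note H = H[unfolded k]
  show "cube_induced q X Y f K = cube_induced q X Y g K"
  proof (cases "K \<in> carrier (cube_homology_group q X)")
    case True
    then obtain z where z: "z \<in> cube_cycles q X" and K: "K = cube_boundaries q X #>\<^bsub>cube_chain_group q X\<^esub> z"
      by (rule cube_homologyE)
    have zc: "z \<in> carrier (cube_chain_group q X)" "cube_boundary z = 0"
      using z by (auto simp: cube_cycles_def)
    have "cube_boundary (prism k H z) = frag_cmul ((-1) ^ Suc q) (cube_map f z - cube_map g z)"
      using cube_boundary_prism[OF assms(1) H(3,4) zc(1) H(1,2)] zc(2) by simp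
    \<comment> \<open>Multiplying by the sign once more cancels it and exhibits the difference
      itself as a boundary.\<close>
    then have "cube_boundary (frag_cmul ((-1) ^ Suc q) (prism k H z)) = cube_map f z - cube_map g z"
      by (simp add: cube_boundary_cmul power_mult_distrib[symmetric] flip: power_add mult_2)
    moreover have "frag_cmul ((-1) ^ Suc q) (prism k H z) \<in> carrier (cube_chain_group (Suc q) Y)"
      using prism_in[OF assms(1) H(3,4) zc(1)] by (simp add: carrier_cube_chain_group subset_iff)
    ultimately have "cube_map f z - cube_map g z \<in> cube_boundaries q Y"
      unfolding cube_boundaries_def by (metis imageI)
    then show ?thesis
      unfolding K cube_induced_class[OF cube_chain_map_cube_map[OF assms(2,1)] z]
        cube_induced_class[OF cube_chain_map_cube_map[OF assms(3,1)] z]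
      by (rule cube_boundaries_coset_eq)
  \<comment> \<open>Outside the carrier both restricted maps are \<open>undefined\<close>.\<close>
  qed (simp add: cube_induced_def)
qed

theorem theorem41:
  fixes m n :: nat and X Y :: "int list set" and f g :: "int list \<Rightarrow> int list"
  assumes "X \<subseteq> int_lattice m" and "Y \<subseteq> int_lattice n"
    and "c1_continuous X Y f" and "c1_continuous X Y g"
    and "c1_homotopic X Y f g"
  shows "(m \<le> 3 \<longrightarrow> (\<forall>q. cube_induced q X Y f = cube_induced q X Y g)) \<and>
         ((\<forall>a b A B h. A \<subseteq> int_lattice a \<longrightarrow> B \<subseteq> int_lattice b \<longrightarrow> c1_continuous A B h \<longrightarrow>
              cube_chain_map A B (cube_map h)) \<longrightarrow>
            (\<forall>q. cube_induced q X Y f = cube_induced q X Y g))"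
  using homotopic_cube_induced_eq[OF assms(2-5)] by blast

end
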